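(* Let $\mathbb{K}$ be an arbitrary field. There is a non-empty Zariski open subset $U$ of $\mathbb{K}^9$ such that for every $\xi\in U$, both $A=\widehat{Q}^{\xi}$ and its dual algebra $A^!$ are finite dimensional.
   Context: For $\xi=(p_1,p_2,p_3,q_1,q_2,q_3,r_1,r_2,r_3)\in\mathbb{K}^9$, the generalized Sklyanin algebra $\widehat{Q}^\xi$ is the associative unital $\mathbb{K}$-algebra given by the generators $x,y,z$ and the relations $p_1yz+q_1zy+r_1xx=0$, $p_2zx+q_2xz+r_2yy=0$, $p_3xy+q_3yx+r_3zz=0$. For a quadratic algebra $A=A(V,R)$ (the quotient of the tensor algebra of $V$ by the ideal generated by a subspace $R\subseteq V\otimes V$) and a basis $x_1,\dots,x_n$ of $V$, let $b$ be the bilinear form on the tensor algebra with $b(u,v)=\delta_{u,v}$ for monomials $u,v$ in $x_1,\dots,x_n$; the dual algebra is $A^!=A(V,R^\perp)$, where $R^\perp=\{u\in V\otimes V: b(r,u)=0\text{ for each }r\in R\}$. For $\widehat{Q}^\xi$, $V$ is the span of $x,y,z$ (with this basis used to form the dual) and $R$ is the span of the three defining relations. A subset of $\mathbb{K}^9$ is Zariski open if its complement is the common zero set in $\mathbb{K}^9$ of a family of polynomials with coefficients in $\mathbb{K}$. *)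

theory Defs
  imports
    "HOL-Analysis.Finite_Cartesian_Product"
    "HOL-Library.Numeral_Type"
    "HOL-Library.Poly_Mapping"
    "HOL-Algebra.Embedded_Algebras"
    "HOL-Algebra.QuotRing"
    "HOL-Algebra.Algebraic_Closure_Type"
begin

section \<open>The tensor algebra\<close>

text \<open>
  Lists form the free monoid, written additively because the multiplication of
  \<^typ>\<open>'a \<Rightarrow>\<^sub>0 'b\<close> is convolution over an additive monoid.
\<close>

instantiation list :: (type) monoid_add
begin

definition zero_list :: "'a list" where "zero_list = []"

definition plus_list :: "'a list \<Rightarrow> 'a list \<Rightarrow> 'a list" where "plus_list = append"

instance by standard (simp_all add: zero_list_def plus_list_def)

end

text \<open>
  The tensor algebra of the vector space with basis \<^typ>\<open>'g\<close>: finitely supported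
  families of coefficients indexed by the monomials, which are words over \<^typ>\<open>'g\<close>.
\<close>

type_synonym ('g, 'k) tensor = "'g list \<Rightarrow>\<^sub>0 'k"

abbreviation monomial :: "'g list \<Rightarrow> ('g, 'k::field) tensor"
  where "monomial w \<equiv> Poly_Mapping.single w 1"

definition scale :: "'k::field \<Rightarrow> ('g, 'k) tensor \<Rightarrow> ('g, 'k) tensor"
  where "scale c u = Poly_Mapping.single [] c * u"

global_interpretation tensor: vector_space "scale :: 'k::field \<Rightarrow> ('g, 'k) tensor \<Rightarrow> _"
  defines tensor_span = tensor.span
proof
  fix a b :: 'k and u v :: "('g, 'k) tensor"
  show "scale a (u + v) = scale a u + scale a v"
    by (simp add: scale_def distrib_left)
  show "scale (a + b) u = scale a u + scale b u"
    by (simp add: scale_def single_add distrib_right)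
  show "scale a (scale b u) = scale (a * b) u"
    by (simp add: scale_def mult.assoc [symmetric] mult_single flip: zero_list_def)
  show "scale 1 u = u"
    by (simp add: scale_def flip: zero_list_def)
qed

definition tensor_algebra :: "('g, 'k::field) tensor ring"
  where "tensor_algebra = ring_of_type_algebra"


section \<open>Quadratic algebras and their duals\<close>

text \<open>The subspace \<open>V \<otimes> V\<close> of the tensor algebra.\<close>

definition quadratic_tensors :: "('g, 'k::field) tensor set"
  where "quadratic_tensors = {u. Poly_Mapping.keys u \<subseteq> {w. length w = 2}}"

text \<open>
  The bilinear form for which the monomials are orthonormal, and the orthogonal
  complement of \<open>R\<close> inside \<open>V \<otimes> V\<close> with respect to it.
\<close>

definition monomial_form :: "('g, 'k::field) tensor \<Rightarrow> ('g, 'k) tensor \<Rightarrow> 'k"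
  where "monomial_form u v =
    (\<Sum>w\<in>Poly_Mapping.keys u. Poly_Mapping.lookup u w * Poly_Mapping.lookup v w)"

definition quadratic_perp :: "('g, 'k::field) tensor set \<Rightarrow> ('g, 'k) tensor set"
  where "quadratic_perp R = {u \<in> quadratic_tensors. \<forall>r\<in>R. monomial_form r u = 0}"

definition relation_ideal :: "('g, 'k::field) tensor set \<Rightarrow> ('g, 'k) tensor set"
  where "relation_ideal R = Idl\<^bsub>tensor_algebra\<^esub> R"

text \<open>The algebra \<open>A(V, R)\<close> for a subspace \<open>R\<close> of \<^const>\<open>quadratic_tensors\<close>.\<close>

definition quadratic_algebra :: "('g, 'k::field) tensor set \<Rightarrow> ('g, 'k) tensor set ring"
  where "quadratic_algebra R = tensor_algebra Quot relation_ideal R"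

definition dual_algebra :: "('g, 'k::field) tensor set \<Rightarrow> ('g, 'k) tensor set ring"
  where "dual_algebra R = quadratic_algebra (quadratic_perp R)"

text \<open>
  In a quotient \<open>A\<close> of the tensor algebra, the zero \<open>\<zero>\<^bsub>A\<^esub>\<close> is the defining ideal, so
  \<open>\<zero>\<^bsub>A\<^esub> +> c\<close> is the coset of the constant \<open>c\<close>. These cosets form the image of the
  ground field, over which the dimension is taken.
\<close>

definition ground_field :: "('g, 'k::field) tensor set ring \<Rightarrow> ('g, 'k) tensor set set"
  where "ground_field A =
    (\<lambda>c. \<zero>\<^bsub>A\<^esub> +>\<^bsub>tensor_algebra\<^esub> Poly_Mapping.single [] c) ` UNIV"

definition finite_dimensional :: "('g, 'k::field) tensor set ring \<Rightarrow> bool"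
  where "finite_dimensional A \<longleftrightarrow> ring.finite_dimension A (ground_field A) (carrier A)"


section \<open>Generalized Sklyanin algebras\<close>

datatype gen = gx | gy | gz

text \<open>
  The coordinates of \<open>\<xi>\<close> are listed as \<open>(p1, p2, p3, q1, q2, q3, r1, r2, r3)\<close>. The index
  type \<open>9\<close> is arithmetic modulo 9, so the literals 1 to 9 are its nine distinct
  elements (with \<open>9 = 0\<close>).
\<close>

definition sklyanin_relations :: "'k::field ^ 9 \<Rightarrow> (gen, 'k) tensor set"
  where "sklyanin_relations \<xi> = tensor_span
    {scale (\<xi> $ 1) (monomial [gy, gz]) + scale (\<xi> $ 4) (monomial [gz, gy]) + scale (\<xi> $ 7) (monomial [gx, gx]),
     scale (\<xi> $ 2) (monomial [gz, gx]) + scale (\<xi> $ 5) (monomial [gx, gz]) + scale (\<xi> $ 8) (monomial [gy, gy]),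
     scale (\<xi> $ 3) (monomial [gx, gy]) + scale (\<xi> $ 6) (monomial [gy, gx]) + scale (\<xi> $ 9) (monomial [gz, gz])}"

definition sklyanin_algebra :: "'k::field ^ 9 \<Rightarrow> (gen, 'k) tensor set ring"
  where "sklyanin_algebra \<xi> = quadratic_algebra (sklyanin_relations \<xi>)"

definition sklyanin_dual :: "'k::field ^ 9 \<Rightarrow> (gen, 'k) tensor set ring"
  where "sklyanin_dual \<xi> = dual_algebra (sklyanin_relations \<xi>)"


section \<open>Zariski open sets\<close>

text \<open>
  Polynomials in variables indexed by \<^typ>\<open>'n\<close> are finitely supported families of
  coefficients indexed by exponent vectors.
\<close>

type_synonym ('n, 'k) mpoly = "('n \<Rightarrow>\<^sub>0 nat) \<Rightarrow>\<^sub>0 'k"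

definition eval_mpoly :: "('n::finite, 'k::field) mpoly \<Rightarrow> 'k ^ 'n \<Rightarrow> 'k"
  where "eval_mpoly P a =
    (\<Sum>m\<in>Poly_Mapping.keys P.
       Poly_Mapping.lookup P m * (\<Prod>i\<in>UNIV. (a $ i) ^ Poly_Mapping.lookup m i))"

definition zariski_open :: "('k::field ^ 'n::finite) set \<Rightarrow> bool"
  where "zariski_open U \<longleftrightarrow> (\<exists>F. - U = {a. \<forall>P\<in>F. eval_mpoly P a = 0})"

end

theory Submission
  imports Defs "Jordan_Normal_Form.Determinant"
begin

no_notation Matrix.vec_index (infixl "$" 100)

text \<open>
  A quadratic algebra is finite dimensional as soon as all words of some length \<open>n\<close> lie in its ideal
  of relations. For relations that depend polynomially on a parameter this is an open condition
  (lemma \<open>words_in_two_sided_span_open\<close>): it says that the multiples \<open>u r v\<close> of degree \<open>n\<close> of the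
  relations span the tensors of degree \<open>n\<close>, and a spanning family at one point stays one wherever a
  certain determinant does not vanish. So it suffices to find, over each field, one point
  at which long words vanish both in the algebra and in its dual.

  Over the field with two elements there is little choice. The point used here gives the relations
  \<open>xx = zy\<close>, \<open>yy = xz\<close>, \<open>zz = xy + b yx\<close> with \<open>b = 1\<close> if 3 is invertible and \<open>b = -1\<close> in
  characteristic 3.

  In the dual algebra at this point all words of length 3 vanish (\<open>word_3_in_special_dual_ideal\<close>).

  In the algebra itself \<open>t = xxx = yyy\<close> is central. Words can be rewritten so that \<open>z\<close> occurs at
  most once, among the last two letters, and the words in \<open>x\<close> and \<open>y\<close> of length 6 are multiples of
  \<open>t\<close>; so every word of length 8 is a multiple of \<open>t\<close> (\<open>t_dvd_word_8\<close>). The relations in higher degree give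
  \<open>(1 - b) xyxyy = (2 + b) t xx\<close> (\<open>xyxyy_relation\<close>), from which \<open>t t t t = 0\<close> follows for both
  choices of \<open>b\<close> (\<open>t_power_4\<close>). Therefore all words of length 32 vanish.
\<close>

section \<open>Polynomial functions and Zariski open sets\<close>

definition polynomial_function :: "('k::field ^ 'n::finite \<Rightarrow> 'k) \<Rightarrow> bool"
  where "polynomial_function f \<longleftrightarrow> (\<exists>P. f = eval_mpoly P)"

lemma eval_mpoly_superset:
  assumes "finite M" and "Poly_Mapping.keys P \<subseteq> M"
  shows "eval_mpoly P a = (\<Sum>m\<in>M. Poly_Mapping.lookup P m * (\<Prod>i\<in>UNIV. (a $ i) ^ Poly_Mapping.lookup m i))"
  unfolding eval_mpoly_def
  by (rule sum.mono_neutral_left) (use assms in \<open>auto simp: in_keys_iff\<close>)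

lemma eval_mpoly_add: "eval_mpoly (P + Q) a = eval_mpoly P a + eval_mpoly Q a"
proof -
  have "finite (Poly_Mapping.keys P \<union> Poly_Mapping.keys Q)"
    by simp
  then show ?thesis
    by (subst (1 2 3) eval_mpoly_superset[of "Poly_Mapping.keys P \<union> Poly_Mapping.keys Q"])
       (use Poly_Mapping.keys_add[of P Q] in \<open>auto simp: lookup_add distrib_right sum.distrib\<close>)
qed

lemma eval_mpoly_single: "eval_mpoly (Poly_Mapping.single m c) a = c * (\<Prod>i\<in>UNIV. (a $ i) ^ Poly_Mapping.lookup m i)"
  by (simp add: eval_mpoly_superset[of "{m}"])

lemma polynomial_function_monomial:
  "polynomial_function (\<lambda>a. c * (\<Prod>i\<in>UNIV. (a $ i) ^ Poly_Mapping.lookup m i))"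
  unfolding polynomial_function_def by (rule exI[of _ "Poly_Mapping.single m c"]) (auto simp: eval_mpoly_single)

lemma polynomial_function_const: "polynomial_function (\<lambda>_. c)"
  using polynomial_function_monomial[of c 0] by simp

lemma polynomial_function_add:
  "polynomial_function f \<Longrightarrow> polynomial_function g \<Longrightarrow> polynomial_function (\<lambda>a. f a + g a)"
proof -
  assume "polynomial_function f" and "polynomial_function g"
  then obtain P Q where "f = eval_mpoly P" "g = eval_mpoly Q"
    by (auto simp: polynomial_function_def)
  then have "(\<lambda>a. f a + g a) = eval_mpoly (P + Q)"
    by (auto simp: eval_mpoly_add)
  then show ?thesis
    by (auto simp: polynomial_function_def)
qed

lemma polynomial_function_sum:
  "(\<And>i. i \<in> I \<Longrightarrow> polynomial_function (f i)) \<Longrightarrow> polynomial_function (\<lambda>a. \<Sum>i\<in>I. f i a)"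
  by (induction I rule: infinite_finite_induct)
     (simp_all add: polynomial_function_const polynomial_function_add)

lemma polynomial_function_coordinate: "polynomial_function (\<lambda>a :: 'k::field ^ 'n::finite. a $ i)"
proof -
  have "(\<Prod>j\<in>UNIV. (a $ j) ^ Poly_Mapping.lookup (Poly_Mapping.single i (1::nat)) j) = a $ i" for a :: "'k ^ 'n"
  proof -
    have "(\<Prod>j\<in>UNIV. (a $ j) ^ Poly_Mapping.lookup (Poly_Mapping.single i (1::nat)) j) = (\<Prod>j\<in>UNIV. if j = i then a $ j else 1)"
      by (rule prod.cong) (auto simp: lookup_single)
    then show ?thesis
      by simp
  qed
  then show ?thesis
    using polynomial_function_monomial[of "1 :: 'k" "Poly_Mapping.single i 1"] by simp
qed

text \<open>
  Multiplying out the two finite sums of monomials avoids any appeal to the product in the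
  polynomial ring.
\<close>

lemma polynomial_function_mult:
  assumes "polynomial_function f" and "polynomial_function g"
  shows "polynomial_function (\<lambda>a. f a * g a)"
proof -
  from assms obtain P Q where "f = eval_mpoly P" "g = eval_mpoly Q"
    by (auto simp: polynomial_function_def)
  then have "(\<lambda>a. f a * g a) = (\<lambda>a. \<Sum>m\<in>Poly_Mapping.keys P. \<Sum>n\<in>Poly_Mapping.keys Q.
      (Poly_Mapping.lookup P m * Poly_Mapping.lookup Q n) * (\<Prod>i\<in>UNIV. (a $ i) ^ Poly_Mapping.lookup (m + n) i))"
    by (auto simp: eval_mpoly_def sum_product lookup_add power_add prod.distrib mult_ac intro!: ext sum.cong)
  then show ?thesis
    by (simp add: polynomial_function_sum polynomial_function_monomial)
qed

lemma polynomial_function_prod: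
  "(\<And>i. i \<in> I \<Longrightarrow> polynomial_function (f i)) \<Longrightarrow> polynomial_function (\<lambda>a. \<Prod>i\<in>I. f i a)"
  by (induction I rule: infinite_finite_induct)
     (simp_all add: polynomial_function_const polynomial_function_mult)

lemma zariski_open_nonzero:
  assumes "polynomial_function f"
  shows "zariski_open {a. f a \<noteq> 0}"
proof -
  from assms obtain P where "f = eval_mpoly P"
    by (auto simp: polynomial_function_def)
  then show ?thesis
    unfolding zariski_open_def by (intro exI[of _ "{P}"]) auto
qed

text \<open>
  Row \<open>v\<close> of the matrix is \<open>h v\<close>. The function \<open>d\<close> is its determinant, and \<open>c\<close> is its inverse where
  the determinant does not vanish.
\<close>

lemma invertible_open:
  fixes h :: "'w \<Rightarrow> 'w \<Rightarrow> 'k::field ^ 'n::finite \<Rightarrow> 'k"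
  assumes "finite W"
    and poly: "\<And>v w. v \<in> W \<Longrightarrow> w \<in> W \<Longrightarrow> polynomial_function (h v w)"
    and unit: "\<And>v w. v \<in> W \<Longrightarrow> w \<in> W \<Longrightarrow> h v w a0 = (if v = w then 1 else 0)"
  obtains d where "polynomial_function d" and "d a0 \<noteq> 0"
    and "\<And>a. d a \<noteq> 0 \<Longrightarrow> \<exists>c. \<forall>u\<in>W. \<forall>w\<in>W. (\<Sum>v\<in>W. c u v * h v w a) = (if u = w then 1 else 0)"
proof -
  define n where "n = card W"
  obtain e where e: "bij_betw e {0..<n} W"
    unfolding n_def using ex_bij_betw_nat_finite[OF \<open>finite W\<close>] by blast
  define H where "H a = mat n n (\<lambda>(i, j). h (e i) (e j) a)" for a
  have eW: "e i \<in> W" if "i < n" for i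
    using bij_betwE[OF e] that by simp
  have e_eq: "e i = e j \<longleftrightarrow> i = j" if "i < n" "j < n" for i j
    using e that by (auto simp: bij_betw_def inj_on_def)
  define d where "d a = det (H a)" for a
  show ?thesis
  proof
    have "polynomial_function (\<lambda>a. \<Sum>p | p permutes {0..<n}. signof p * (\<Prod>i = 0..<n. h (e i) (e (p i)) a))"
      by (intro polynomial_function_sum polynomial_function_mult polynomial_function_const
          polynomial_function_prod poly) (auto intro!: eW simp: permutes_in_image dest: permutes_in_image)
    also have "(\<lambda>a. \<Sum>p | p permutes {0..<n}. signof p * (\<Prod>i = 0..<n. h (e i) (e (p i)) a)) = d"
      unfolding d_def det_def H_def
      by (auto intro!: ext sum.cong prod.cong dest: permutes_in_image)
    finally show "polynomial_function d" .
    have "H a0 = 1\<^sub>m n"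
      by (rule eq_matI) (auto simp: H_def unit eW e_eq)
    then show "d a0 \<noteq> 0"
      by (simp add: d_def)
    fix a assume "d a \<noteq> 0"
    then obtain C where C: "C \<in> carrier_mat n n" "C * H a = 1\<^sub>m n"
      using det_non_zero_imp_unit[of "H a" n "()"] unfolding d_def Units_def
      by (auto simp: H_def ring_mat_def)
    define c where "c u v = C $$ (inv_into {0..<n} e u, inv_into {0..<n} e v)" for u v
    have "(\<Sum>v\<in>W. c u v * h v w a) = (if u = w then 1 else 0)" if "u \<in> W" "w \<in> W" for u w
    proof -
      from that obtain i j where ij: "i < n" "u = e i" "j < n" "w = e j"
        using e by (force simp: bij_betw_def)
      have inv: "inv_into {0..<n} e (e k) = k" if "k < n" for k
        using e that by (simp add: bij_betw_inv_into_left)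
      have "(\<Sum>v\<in>W. c u v * h v w a) = (\<Sum>k\<in>{0..<n}. c u (e k) * h (e k) w a)"
        by (rule sum.reindex_bij_betw[OF e, symmetric])
      also have "\<dots> = (C * H a) $$ (i, j)"
        using C(1) ij by (auto simp: c_def inv H_def scalar_prod_def intro!: sum.cong)
      also have "\<dots> = (if u = w then 1 else 0)"
        using C(2) ij by (simp add: e_eq)
      finally show ?thesis .
    qed
    then show "\<exists>c. \<forall>u\<in>W. \<forall>w\<in>W. (\<Sum>v\<in>W. c u v * h v w a) = (if u = w then 1 else 0)"
      by blast
  qed
qed

section \<open>Two-sided ideals of the tensor algebra\<close>

lemma monomial_mult: "monomial u * monomial v = monomial (u @ v)"
  by (simp add: mult_single plus_list_def)

lemma monomial_Nil: "monomial [] = 1"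
  by (simp flip: zero_list_def)

lemma lookup_scale: "Poly_Mapping.lookup (scale c t) w = c * Poly_Mapping.lookup t w"
proof -
  have "scale c t = Poly_Mapping.map ((*) c) t"
    by (simp add: scale_def mult_map_scale_conv_mult zero_list_def)
  then show ?thesis
    by (simp add: Poly_Mapping.map.rep_eq when_def)
qed

lemma scale_monomial: "scale c (monomial w) = Poly_Mapping.single w c"
  by (simp add: scale_def mult_single plus_list_def)

lemma tensor_expansion:
  assumes "finite M" and "Poly_Mapping.keys t \<subseteq> M"
  shows "t = (\<Sum>m\<in>M. scale (Poly_Mapping.lookup t m) (monomial m))"
proof (rule poly_mapping_eqI)
  fix w
  have "(\<Sum>m\<in>M. Poly_Mapping.lookup t m * Poly_Mapping.lookup (monomial m) w)
    = (\<Sum>m\<in>M. if m = w then Poly_Mapping.lookup t m else 0)"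
    by (intro sum.cong) (auto simp: lookup_single)
  also have "\<dots> = Poly_Mapping.lookup t w"
    using assms by (auto simp: in_keys_iff)
  finally show "Poly_Mapping.lookup t w
    = Poly_Mapping.lookup (\<Sum>m\<in>M. scale (Poly_Mapping.lookup t m) (monomial m)) w"
    by (simp add: lookup_sum lookup_scale)
qed

lemma scale_mult_left: "scale c s * t = scale c (s * t)"
  by (simp add: scale_def mult.assoc)

lemma scale_mult_right: "s * scale c t = scale c (s * t)"
proof -
  have "s * Poly_Mapping.single [] c = Poly_Mapping.single [] c * s"
    by (subst (1 2) tensor_expansion[of "Poly_Mapping.keys s" s])
       (simp_all add: sum_distrib_left sum_distrib_right scale_monomial mult_single plus_list_def mult.commute)
  then show ?thesis
    by (metis mult.assoc scale_def)
qed

text \<open>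
  This is the two-sided ideal generated by \<open>G\<close>. Its description by multiples of generators
  by words makes it possible to take homogeneous components and to vary the generators.
\<close>

definition two_sided_span :: "('g, 'k::field) tensor set \<Rightarrow> ('g, 'k) tensor set"
  where "two_sided_span G = tensor_span {monomial u * g * monomial v | u g v. g \<in> G}"

lemma two_sided_span_generator: "g \<in> G \<Longrightarrow> monomial u * g * monomial v \<in> two_sided_span G"
  unfolding two_sided_span_def by (rule tensor.span_base) blast

lemma two_sided_span_superset: "g \<in> G \<Longrightarrow> g \<in> two_sided_span G"
  using two_sided_span_generator[of g G "[]" "[]"] by (simp add: monomial_Nil)

lemma two_sided_span_induct [consumes 1, case_names zero add scale generator]:
  assumes "t \<in> two_sided_span G"
    and "P 0" and "\<And>s t. P s \<Longrightarrow> P t \<Longrightarrow> P (s + t)" and "\<And>c t. P t \<Longrightarrow> P (scale c t)"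
    and "\<And>u g v. g \<in> G \<Longrightarrow> P (monomial u * g * monomial v)"
  shows "P t"
  using assms(1) unfolding two_sided_span_def
  by (rule tensor.span_induct) (use assms(2-) in \<open>auto simp: tensor.subspace_def\<close>)

lemma two_sided_span_closed:
  shows two_sided_span_zero: "0 \<in> two_sided_span G"
    and two_sided_span_add: "s \<in> two_sided_span G \<Longrightarrow> t \<in> two_sided_span G \<Longrightarrow> s + t \<in> two_sided_span G"
    and two_sided_span_diff: "s \<in> two_sided_span G \<Longrightarrow> t \<in> two_sided_span G \<Longrightarrow> s - t \<in> two_sided_span G"
    and two_sided_span_scale: "t \<in> two_sided_span G \<Longrightarrow> scale c t \<in> two_sided_span G"
    and two_sided_span_sum: "(\<And>i. i \<in> I \<Longrightarrow> f i \<in> two_sided_span G) \<Longrightarrow> (\<Sum>i\<in>I. f i) \<in> two_sided_span G"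
  unfolding two_sided_span_def
  by (auto intro: tensor.span_zero tensor.span_add tensor.span_diff tensor.span_scale tensor.span_sum)

lemma two_sided_span_mult:
  assumes "t \<in> two_sided_span G"
  shows "s * t \<in> two_sided_span G" and "t * s \<in> two_sided_span G"
proof -
  have left: "monomial w * t \<in> two_sided_span G" for w
    using assms
  proof (induction rule: two_sided_span_induct)
    case (generator u g v)
    have "monomial w * (monomial u * g * monomial v) = monomial (w @ u) * g * monomial v"
      by (simp add: monomial_mult flip: mult.assoc)
    then show ?case
      using generator by (simp add: two_sided_span_generator)
  qed (auto simp: distrib_left scale_mult_right intro: two_sided_span_closed)
  have right: "t * monomial w \<in> two_sided_span G" for w
    using assms
  proof (induction rule: two_sided_span_induct)
    case (generator u g v)
    have "monomial u * g * monomial v * monomial w = monomial u * g * monomial (v @ w)"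
      by (simp add: monomial_mult mult.assoc)
    then show ?case
      using generator by (simp add: two_sided_span_generator)
  qed (auto simp: distrib_right scale_mult_left intro: two_sided_span_closed)
  have s: "s = (\<Sum>m\<in>Poly_Mapping.keys s. scale (Poly_Mapping.lookup s m) (monomial m))"
    by (rule tensor_expansion) auto
  show "s * t \<in> two_sided_span G"
    by (subst s) (auto simp: sum_distrib_right scale_mult_left intro!: two_sided_span_sum two_sided_span_scale left)
  show "t * s \<in> two_sided_span G"
    by (subst s) (auto simp: sum_distrib_left scale_mult_right intro!: two_sided_span_sum two_sided_span_scale right)
qed

section \<open>Words in an ideal as an open condition\<close>

abbreviation words :: "nat \<Rightarrow> 'g list set" where "words n \<equiv> {w. length w = n}"

lemma finite_words: "finite (words n :: 'g::finite list set)"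
  using finite_lists_length_eq[of "UNIV :: 'g set" n] by simp

definition homogeneous_part :: "nat \<Rightarrow> ('g, 'k::field) tensor \<Rightarrow> ('g, 'k) tensor"
  where "homogeneous_part n t = (\<Sum>w\<in>words n. scale (Poly_Mapping.lookup t w) (monomial w))"

lemma homogeneous_part_linear:
  "homogeneous_part n 0 = 0"
  "homogeneous_part n (s + t) = homogeneous_part n s + homogeneous_part n t"
  "homogeneous_part n (scale c t) = scale c (homogeneous_part n t)"
  by (simp_all add: homogeneous_part_def lookup_add tensor.scale_left_distrib sum.distrib lookup_scale tensor.scale_sum_right)

lemma homogeneous_part_id:
  fixes t :: "('g::finite, 'k::field) tensor"
  shows "Poly_Mapping.keys t \<subseteq> words n \<Longrightarrow> homogeneous_part n t = t"
  unfolding homogeneous_part_def by (rule tensor_expansion[symmetric]) (simp_all add: finite_words)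

lemma homogeneous_part_other:
  "Poly_Mapping.keys t \<subseteq> words m \<Longrightarrow> m \<noteq> n \<Longrightarrow> homogeneous_part n t = 0"
  unfolding homogeneous_part_def by (rule sum.neutral) (auto simp: in_keys_iff subset_iff)

lemma multiple_expansion:
  fixes g :: "('g::finite, 'k::field) tensor"
  assumes "g \<in> quadratic_tensors"
  shows "monomial u * g * monomial v
    = (\<Sum>m\<in>words 2. scale (Poly_Mapping.lookup g m) (monomial (u @ m @ v)))"
proof -
  have "g = (\<Sum>m\<in>words 2. scale (Poly_Mapping.lookup g m) (monomial m))"
    using assms by (intro tensor_expansion) (simp_all add: quadratic_tensors_def finite_words)
  then have "monomial u * g * monomial v
    = monomial u * (\<Sum>m\<in>words 2. scale (Poly_Mapping.lookup g m) (monomial m)) * monomial v"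
    by simp
  then show ?thesis
    by (simp add: sum_distrib_left sum_distrib_right scale_mult_left scale_mult_right monomial_mult)
qed

lemma keys_multiple:
  fixes g :: "('g::finite, 'k::field) tensor"
  assumes "g \<in> quadratic_tensors"
  shows "Poly_Mapping.keys (monomial u * g * monomial v) \<subseteq> words (length u + length v + 2)"
proof
  fix w
  assume "w \<in> Poly_Mapping.keys (monomial u * g * monomial v)"
  then have "(\<Sum>m\<in>words 2. Poly_Mapping.lookup g m * Poly_Mapping.lookup (monomial (u @ m @ v) :: ('g, 'k) tensor) w) \<noteq> 0"
    by (simp add: in_keys_iff multiple_expansion[OF assms] lookup_sum lookup_scale)
  then obtain m where "m \<in> words 2" "Poly_Mapping.lookup (monomial (u @ m @ v) :: ('g, 'k) tensor) w \<noteq> 0"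
    by (metis (lifting) mult_zero_right sum.neutral)
  then show "w \<in> words (length u + length v + 2)"
    by (auto simp: lookup_single when_def split: if_splits)
qed

text \<open>
  For quadratic generators the ideal is graded: in degree \<open>n\<close> only the finitely many multiples of
  degree \<open>n\<close> contribute.
\<close>

lemma homogeneous_part_two_sided_span:
  fixes g :: "'j::finite \<Rightarrow> ('g::finite, 'k::field) tensor"
  assumes quad: "\<And>j. g j \<in> quadratic_tensors"
    and "t \<in> two_sided_span (range g)"
  shows "\<exists>c. homogeneous_part n t = (\<Sum>(u, j, v) | length u + length v + 2 = n.
    scale (c u j v) (monomial u * g j * monomial v))"
    (is "\<exists>c. ?P t c")
  using assms(2)
proof (induction rule: two_sided_span_induct)
  case zero
  then show ?case
    by (intro exI[of _ "\<lambda>_ _ _. 0"]) (auto simp: homogeneous_part_linear intro!: sum.neutral[symmetric])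
next
  case (add s t)
  then obtain c d where "?P s c" "?P t d"
    by blast
  then have "?P (s + t) (\<lambda>u j v. c u j v + d u j v)"
    by (auto simp: homogeneous_part_linear tensor.scale_left_distrib simp flip: sum.distrib intro!: sum.cong)
  then show ?case
    by (intro exI[of _ "\<lambda>u j v. c u j v + d u j v"])
next
  case (scale e t)
  then obtain c where "?P t c"
    by blast
  then have "?P (scale e t) (\<lambda>u j v. e * c u j v)"
    by (auto simp: homogeneous_part_linear tensor.scale_sum_right intro!: sum.cong)
  then show ?case
    by (intro exI[of _ "\<lambda>u j v. e * c u j v"])
next
  case (generator u g' v)
  let ?A = "{(u :: 'g list, j :: 'j, v :: 'g list). length u + length v + 2 = n}"
  obtain j where g': "g' = g j"
    using generator by blast
  show ?case
  proof (cases "length u + length v + 2 = n")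
    case True
    have "?A \<subseteq> {u. length u \<le> n} \<times> UNIV \<times> {v. length v \<le> n}"
      by auto
    then have "finite ?A"
      using finite_lists_length_le[of "UNIV :: 'g set" n] by (elim finite_subset) auto
    have "homogeneous_part n (monomial u * g j * monomial v) = monomial u * g j * monomial v"
      using keys_multiple[OF quad] True by (intro homogeneous_part_id) auto
    also have "\<dots> = (\<Sum>a\<in>?A. if a = (u, j, v) then monomial u * g j * monomial v else 0)"
      using True \<open>finite ?A\<close> by simp
    also have "\<dots> = (\<Sum>(u', j', v')\<in>?A. scale (if (u', j', v') = (u, j, v) then 1 else 0) (monomial u' * g j' * monomial v'))"
    proof (rule sum.cong[OF refl])
      fix a :: "'g list \<times> 'j \<times> 'g list"
      show "(if a = (u, j, v) then monomial u * g j * monomial v else 0)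
        = (case a of (u', j', v') \<Rightarrow> scale (if (u', j', v') = (u, j, v) then 1 else 0) (monomial u' * g j' * monomial v'))"
        by (cases a) auto
    qed
    finally show ?thesis
      unfolding g' by (intro exI[of _ "\<lambda>u' j' v'. if (u', j', v') = (u, j, v) then 1 else 0"])
  next
    case False
    then have "homogeneous_part n (monomial u * g j * monomial v) = 0"
      using keys_multiple[OF quad] by (intro homogeneous_part_other) auto
    also have "\<dots> = (\<Sum>(u', j', v')\<in>?A. scale 0 (monomial u' * g j' * monomial v'))"
      by (auto intro!: sum.neutral[symmetric])
    finally show ?thesis
      unfolding g' by (intro exI[of _ "\<lambda>_ _ _. 0"])
  qed
qed

text \<open>
  At the point \<open>a0\<close> each word of length \<open>n\<close> is a combination of multiples of the relations. Keep the
  coefficients of these combinations and let the relations vary with \<open>a\<close>. The result is a family of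
  elements \<open>r w a\<close> of the ideal at \<open>a\<close>, homogeneous of degree \<open>n\<close>, whose coordinates form a square
  matrix that depends polynomially on \<open>a\<close> and is the identity at \<open>a0\<close>. Where its determinant does
  not vanish, the words can be recovered from the \<open>r w a\<close>.
\<close>

lemma words_in_two_sided_span_open:
  fixes g :: "'k::field ^ 'n::finite \<Rightarrow> 'j::finite \<Rightarrow> ('g::finite, 'k) tensor"
  assumes quad: "\<And>a j. g a j \<in> quadratic_tensors"
    and poly: "\<And>j m. polynomial_function (\<lambda>a. Poly_Mapping.lookup (g a j) m)"
    and a0: "\<And>w. length w = n \<Longrightarrow> monomial w \<in> two_sided_span (range (g a0))"
  obtains d where "polynomial_function d" and "d a0 \<noteq> 0"
    and "\<And>a w. d a \<noteq> 0 \<Longrightarrow> length w = n \<Longrightarrow> monomial w \<in> two_sided_span (range (g a))"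
proof -
  let ?A = "{(u :: 'g list, j :: 'j, v :: 'g list). length u + length v + 2 = n}"
  have "\<exists>c. monomial w = (\<Sum>(u, j, v)\<in>?A. scale (c u j v) (monomial u * g a0 j * monomial v))"
    if "length w = n" for w
  proof -
    have "homogeneous_part n (monomial w) = (monomial w :: ('g, 'k) tensor)"
      using that by (intro homogeneous_part_id) auto
    then show ?thesis
      using homogeneous_part_two_sided_span[of "g a0", OF quad a0[OF that], of n] by simp
  qed
  then have "\<forall>w\<in>words n. \<exists>c. monomial w = (\<Sum>(u, j, v)\<in>?A. scale (c u j v) (monomial u * g a0 j * monomial v))"
    by simp
  from bchoice[OF this] obtain c where c: "monomial w = (\<Sum>(u, j, v)\<in>?A. scale (c w u j v) (monomial u * g a0 j * monomial v))"
    if "length w = n" for w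
    by auto
  define r where "r w a = (\<Sum>(u, j, v)\<in>?A. scale (c w u j v) (monomial u * g a j * monomial v))" for w a
  have r_span: "r w a \<in> two_sided_span (range (g a))" for w a
    unfolding r_def by (auto intro!: two_sided_span_sum two_sided_span_scale two_sided_span_generator)
  have r_homogeneous: "Poly_Mapping.lookup (r w a) v = 0" if "length v \<noteq> n" for w a v
  proof -
    have "Poly_Mapping.lookup (monomial u * g a j * monomial u') v = 0"
      if "length u + length u' + 2 = n" for u j u'
      using keys_multiple[OF quad, of u a j u'] \<open>length v \<noteq> n\<close> that by (auto simp: in_keys_iff)
    then show ?thesis
      by (auto simp: r_def lookup_sum lookup_scale intro!: sum.neutral)
  qed
  define h where "h w v a = Poly_Mapping.lookup (r w a) v" for w v a
  have "h w v = (\<lambda>a. \<Sum>(u, j, u')\<in>?A. c w u j u' * (\<Sum>m\<in>words 2. Poly_Mapping.lookup (g a j) m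
      * Poly_Mapping.lookup (monomial (u @ m @ u') :: ('g, 'k) tensor) v))" for w v
    by (rule ext) (simp add: h_def r_def lookup_sum lookup_scale multiple_expansion[OF quad] case_prod_beta)
  then have h_poly: "polynomial_function (h w v)" for w v
    by (auto simp: case_prod_beta
        intro!: polynomial_function_sum polynomial_function_mult polynomial_function_const poly)
  have h_unit: "h w v a0 = (if w = v then 1 else 0)" if "w \<in> words n" for w v
  proof -
    have "r w a0 = monomial w"
      unfolding r_def using that by (intro c[symmetric]) simp
    then show ?thesis
      by (simp add: h_def lookup_single when_def)
  qed
  obtain d where d: "polynomial_function d" "d a0 \<noteq> 0"
    and inverse: "\<And>a. d a \<noteq> 0 \<Longrightarrow> \<exists>e. \<forall>u\<in>words n. \<forall>w\<in>words n. (\<Sum>v\<in>words n. e u v * h v w a) = (if u = w then 1 else 0)"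
  proof (rule invertible_open[OF finite_words[where n = n], of h a0])
    show "polynomial_function (h v w)" for v w
      by (rule h_poly)
    show "h v w a0 = (if v = w then 1 else 0)" if "v \<in> words n" for v w
      using that by (rule h_unit)
  qed (rule that)
  have "monomial w \<in> two_sided_span (range (g a))" if "d a \<noteq> 0" and w: "length w = n" for a w
  proof -
    obtain e where e: "\<And>u w. length u = n \<Longrightarrow> length w = n \<Longrightarrow> (\<Sum>v\<in>words n. e u v * h v w a) = (if u = w then 1 else 0)"
      using inverse[OF \<open>d a \<noteq> 0\<close>] by auto
    have "(\<Sum>v\<in>words n. scale (e w v) (r v a)) = monomial w"
    proof (rule poly_mapping_eqI)
      fix w'
      show "Poly_Mapping.lookup (\<Sum>v\<in>words n. scale (e w v) (r v a)) w' = Poly_Mapping.lookup (monomial w) w'"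
      proof (cases "length w' = n")
        case True
        then show ?thesis
          using e[OF w True] by (simp add: lookup_sum lookup_scale lookup_single when_def flip: h_def)
      next
        case False
        then show ?thesis
          using w by (auto simp: lookup_sum lookup_scale lookup_single when_def r_homogeneous)
      qed
    qed
    moreover have "(\<Sum>v\<in>words n. scale (e w v) (r v a)) \<in> two_sided_span (range (g a))"
      by (intro two_sided_span_sum two_sided_span_scale r_span)
    ultimately show ?thesis
      by simp
  qed
  then show ?thesis
    using that d by blast
qed

section \<open>A criterion for finite dimension\<close>

lemma tensor_algebra_simps [simp]:
  "carrier tensor_algebra = UNIV" "s \<otimes>\<^bsub>tensor_algebra\<^esub> t = s * t" "s \<oplus>\<^bsub>tensor_algebra\<^esub> t = s + t"
  "\<one>\<^bsub>tensor_algebra\<^esub> = 1" "\<zero>\<^bsub>tensor_algebra\<^esub> = 0"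
  by (simp_all add: tensor_algebra_def ring_of_type_algebra_def)

lemma ring_tensor_algebra: "ring (tensor_algebra :: ('g, 'k::field) tensor ring)"
proof -
  have "\<exists>y. x + y = 0" for x :: "('g, 'k) tensor"
    using add.right_inverse by blast
  then show ?thesis
    unfolding tensor_algebra_def ring_of_type_algebra_def using add.right_inverse
    by unfold_locales (auto simp: algebra_simps Units_def)
qed

lemma two_sided_span_subset_relation_ideal:
  assumes "G \<subseteq> relation_ideal R"
  shows "two_sided_span G \<subseteq> relation_ideal R"
proof
  interpret ring "tensor_algebra :: ('a, 'b) tensor ring"
    by (rule ring_tensor_algebra)
  interpret I: ideal "relation_ideal R" "tensor_algebra :: ('a, 'b) tensor ring"
    unfolding relation_ideal_def by (rule genideal_ideal) simp
  fix t assume "t \<in> two_sided_span G"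
  then show "t \<in> relation_ideal R"
  proof (induction rule: two_sided_span_induct)
    case zero
    then show ?case using I.zero_closed by simp
  next
    case (add s t)
    then show ?case using I.a_closed by simp
  next
    case (scale c t)
    then show ?case using I.I_l_closed[of t "Poly_Mapping.single [] c"] by (simp add: scale_def)
  next
    case (generator u g v)
    then have "g \<in> relation_ideal R"
      using assms by blast
    then have "monomial u * g \<in> relation_ideal R"
      using I.I_l_closed[of g "monomial u"] by simp
    then show ?case
      using I.I_r_closed[of "monomial u * g" "monomial v"] by simp
  qed
qed

lemma relation_ideal_superset: "R \<subseteq> relation_ideal R"
proof -
  interpret ring "tensor_algebra :: ('a, 'b) tensor ring"
    by (rule ring_tensor_algebra)
  show ?thesis
    unfolding relation_ideal_def by (rule genideal_self) simp
qed

text \<open>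
  The constants are the image of the ground field under a ring homomorphism to a nonzero ring.
\<close>

lemma constants_subfield: "subfield (range (Poly_Mapping.single [])) (tensor_algebra :: ('g, 'k::field) tensor ring)"
proof -
  interpret F: Ring.field "ring_of_type_algebra :: 'k ring"
    by (rule field_from_type_algebra)
  have "ring_hom_ring (ring_of_type_algebra :: 'k ring) (tensor_algebra :: ('g, 'k) tensor ring) (Poly_Mapping.single [])"
    by (intro ring_hom_ringI F.ring_axioms ring_tensor_algebra)
      (simp_all add: ring_of_type_algebra_def single_add mult_single plus_list_def monomial_Nil)
  then show ?thesis
    using ring_hom_ring.img_is_subfield(2)[OF _ F.carrier_is_subfield] by (fastforce simp: ring_of_type_algebra_def)
qed

text \<open>
  The words of length at most \<open>n\<close> span the quotient over the image of the ground field. That image is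
  a field unless the quotient is the zero ring, which has dimension 0 over any set of scalars.
\<close>

lemma finite_dimensional_quadratic_algebra:
  fixes R :: "('g::finite, 'k::field) tensor set"
  assumes words: "\<And>w. length w = n \<Longrightarrow> monomial w \<in> relation_ideal R"
  shows "finite_dimensional (quadratic_algebra R)"
proof -
  let ?T = "tensor_algebra :: ('g, 'k) tensor ring"
  let ?I = "relation_ideal R"
  interpret T: ring ?T
    by (rule ring_tensor_algebra)
  interpret I: ideal ?I ?T
    unfolding relation_ideal_def by (rule T.genideal_ideal) simp
  define Q where "Q = quadratic_algebra R"
  have Q: "Q = ?T Quot ?I"
    by (simp add: Q_def quadratic_algebra_def)
  interpret Q: ring Q
    unfolding Q by (rule I.quotient_is_ring)
  define \<pi> where "\<pi> t = ?I +>\<^bsub>?T\<^esub> t" for t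
  interpret hom: ring_hom_ring ?T Q \<pi>
    unfolding Q \<pi>_def by (rule I.rcos_ring_hom_ring)
  have carrier: "carrier Q = range \<pi>"
    by (auto simp: Q \<pi>_def FactRing_def A_RCOSETS_def')
  have zero: "\<zero>\<^bsub>Q\<^esub> = ?I"
    by (simp add: Q FactRing_def)
  have ground: "ground_field Q = \<pi> ` range (Poly_Mapping.single [])"
    by (auto simp: ground_field_def zero \<pi>_def)
  have "Q.finite_dimension (ground_field Q) (carrier Q)"
  proof (cases "\<one>\<^bsub>Q\<^esub> = \<zero>\<^bsub>Q\<^esub>")
    case True
    then have "carrier Q = {\<zero>\<^bsub>Q\<^esub>}"
      by (simp add: Q.one_zeroD)
    then show ?thesis
      by (simp add: Q.finite_dimension_def Q.zero_dim) (rule exI, rule Q.zero_dim)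
  next
    case False
    have K: "subfield (ground_field Q) Q"
      unfolding ground by (rule hom.img_is_subfield[OF constants_subfield False])
    obtain ws :: "'g list list" where ws: "set ws = {w. length w \<le> n}"
      using finite_list[OF finite_lists_length_le[of "UNIV :: 'g set" n]] by auto
    define S where "S = Q.Span (ground_field Q) (map (\<lambda>w. \<pi> (monomial w)) ws)"
    have Us: "set (map (\<lambda>w. \<pi> (monomial w)) ws) \<subseteq> carrier Q"
      by (auto simp: carrier)
    have sub: "subgroup S (add_monoid Q)"
      unfolding S_def by (rule Q.Span_is_add_subgroup[OF K Us])
    have "\<pi> (scale c (monomial w)) \<in> S" for c w
    proof (cases "length w \<le> n")
      case True
      then have "\<pi> (monomial w) \<in> S"
        unfolding S_def using Q.Span_base_incl[OF K Us] ws by auto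
      then have "\<pi> (Poly_Mapping.single [] c) \<otimes>\<^bsub>Q\<^esub> \<pi> (monomial w) \<in> S"
        unfolding S_def by (intro Q.Span_smult_closed[OF K Us]) (auto simp: ground)
      then show ?thesis
        using hom.hom_mult[of "Poly_Mapping.single [] c" "monomial w"] by (simp add: scale_def)
    next
      case False
      \<comment> \<open>a long word has a prefix in the ideal, so its class is zero\<close>
      then have "monomial (take n w) \<in> ?I"
        by (intro words) auto
      then have "monomial (take n w) * monomial (drop n w) \<in> ?I"
        using I.I_r_closed[of "monomial (take n w)" "monomial (drop n w)"] by simp
      then have "monomial w \<in> ?I"
        by (simp add: monomial_mult)
      then have "scale c (monomial w) \<in> ?I"
        using I.I_l_closed[of "monomial w" "Poly_Mapping.single [] c"] by (simp add: scale_def)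
      then have "\<pi> (scale c (monomial w)) = \<zero>\<^bsub>Q\<^esub>"
        unfolding zero \<pi>_def by (intro I.a_rcos_const) simp
      then show ?thesis
        using subgroup.one_closed[OF sub] by simp
    qed
    note term_in_S = this
    have sums: "\<pi> (\<Sum>w\<in>M. scale (c w) (monomial w)) \<in> S" if "finite M" for M c
      using that
    proof (induction M)
      case empty
      then show ?case
        using subgroup.one_closed[OF sub] hom.hom_zero by simp
    next
      case (insert w M)
      then show ?case
        using term_in_S[of "c w" w] subgroup.m_closed[OF sub, of "\<pi> (scale (c w) (monomial w))" "\<pi> (\<Sum>w\<in>M. scale (c w) (monomial w))"]
          hom.hom_add[of "scale (c w) (monomial w)" "\<Sum>w\<in>M. scale (c w) (monomial w)"] by simp
    qed
    have "\<pi> t \<in> S" for t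
      using sums[of "Poly_Mapping.keys t" "Poly_Mapping.lookup t"]
        tensor_expansion[of "Poly_Mapping.keys t" t] by simp
    then have "carrier Q = S"
      using subgroup.subset[OF sub] by (auto simp: carrier)
    then show ?thesis
      using Q.Span_finite_dimension[OF K Us] by (simp add: S_def)
  qed
  then show ?thesis
    by (simp add: finite_dimensional_def Q_def)
qed

section \<open>The relations of the Sklyanin algebras and of their duals\<close>

instance gen :: finite
proof
  have "UNIV = {gx, gy, gz}"
    using gen.exhaust by auto
  then show "finite (UNIV :: gen set)"
    by (metis finite.emptyI finite.insertI)
qed

fun sklyanin_relator :: "'k::field ^ 9 \<Rightarrow> gen \<Rightarrow> (gen, 'k) tensor" where
  "sklyanin_relator \<xi> gx = scale (\<xi> $ 1) (monomial [gy, gz]) + scale (\<xi> $ 4) (monomial [gz, gy]) + scale (\<xi> $ 7) (monomial [gx, gx])"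
| "sklyanin_relator \<xi> gy = scale (\<xi> $ 2) (monomial [gz, gx]) + scale (\<xi> $ 5) (monomial [gx, gz]) + scale (\<xi> $ 8) (monomial [gy, gy])"
| "sklyanin_relator \<xi> gz = scale (\<xi> $ 3) (monomial [gx, gy]) + scale (\<xi> $ 6) (monomial [gy, gx]) + scale (\<xi> $ 9) (monomial [gz, gz])"

text \<open>
  Elements of the orthogonal complement that depend polynomially on \<open>\<xi>\<close> and are there for all
  values of \<open>\<xi>\<close>: for \<open>p yz + q zy + r xx\<close> they are \<open>r yz - p xx\<close> and \<open>r zy - q xx\<close>. Where the
  \<open>r\<close> are nonzero, as they are at the special point below, they span the complement.
\<close>

fun dual_relator :: "'k::field ^ 9 \<Rightarrow> gen \<times> bool \<Rightarrow> (gen, 'k) tensor" where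
  "dual_relator \<xi> (gx, True) = scale (\<xi> $ 7) (monomial [gy, gz]) - scale (\<xi> $ 1) (monomial [gx, gx])"
| "dual_relator \<xi> (gx, False) = scale (\<xi> $ 7) (monomial [gz, gy]) - scale (\<xi> $ 4) (monomial [gx, gx])"
| "dual_relator \<xi> (gy, True) = scale (\<xi> $ 8) (monomial [gz, gx]) - scale (\<xi> $ 2) (monomial [gy, gy])"
| "dual_relator \<xi> (gy, False) = scale (\<xi> $ 8) (monomial [gx, gz]) - scale (\<xi> $ 5) (monomial [gy, gy])"
| "dual_relator \<xi> (gz, True) = scale (\<xi> $ 9) (monomial [gx, gy]) - scale (\<xi> $ 3) (monomial [gz, gz])"
| "dual_relator \<xi> (gz, False) = scale (\<xi> $ 9) (monomial [gy, gx]) - scale (\<xi> $ 6) (monomial [gz, gz])"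

lemma quadratic_tensorsI: "(\<And>w. length w \<noteq> 2 \<Longrightarrow> Poly_Mapping.lookup t w = 0) \<Longrightarrow> t \<in> quadratic_tensors"
  unfolding quadratic_tensors_def by (auto simp: in_keys_iff)

lemma sklyanin_relator_quadratic: "sklyanin_relator \<xi> j \<in> quadratic_tensors"
  by (rule quadratic_tensorsI, cases j) (auto simp: lookup_add lookup_scale lookup_single when_def)

lemma dual_relator_quadratic: "dual_relator \<xi> j \<in> quadratic_tensors"
  by (rule quadratic_tensorsI, cases "(\<xi>, j)" rule: dual_relator.cases)
     (auto simp: lookup_minus lookup_scale lookup_single when_def)

lemma polynomial_function_diff:
  assumes "polynomial_function f" and "polynomial_function g"
  shows "polynomial_function (\<lambda>a. f a - g a)"
  using polynomial_function_add[OF assms(1) polynomial_function_mult[OF polynomial_function_const[of "- 1"] assms(2)]]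
  by simp

lemma sklyanin_relator_polynomial: "polynomial_function (\<lambda>\<xi> :: 'k::field ^ 9. Poly_Mapping.lookup (sklyanin_relator \<xi> j) w)"
  by (cases j) (auto simp: lookup_add lookup_scale intro!: polynomial_function_add
      polynomial_function_mult polynomial_function_coordinate polynomial_function_const)

lemma dual_relator_polynomial: "polynomial_function (\<lambda>\<xi> :: 'k::field ^ 9. Poly_Mapping.lookup (dual_relator \<xi> j) w)"
proof -
  obtain k c where "j = (k, c)"
    by (cases j)
  then show ?thesis
    by (cases k; cases c) (auto simp: lookup_minus lookup_scale intro!: polynomial_function_diff
      polynomial_function_mult polynomial_function_coordinate polynomial_function_const)
qed

lemma sklyanin_relator_in_relations: "sklyanin_relator \<xi> j \<in> sklyanin_relations \<xi>"
  unfolding sklyanin_relations_def by (rule tensor.span_base) (cases j; simp)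

text \<open>
  Summing over the support of the second argument shows that the form is linear in the first one.
\<close>

lemma monomial_form_right: "monomial_form u v = (\<Sum>w\<in>Poly_Mapping.keys v. Poly_Mapping.lookup u w * Poly_Mapping.lookup v w)"
proof -
  have "monomial_form u v = (\<Sum>w\<in>Poly_Mapping.keys u \<union> Poly_Mapping.keys v. Poly_Mapping.lookup u w * Poly_Mapping.lookup v w)"
    unfolding monomial_form_def by (rule sum.mono_neutral_left) (auto simp: in_keys_iff)
  also have "\<dots> = (\<Sum>w\<in>Poly_Mapping.keys v. Poly_Mapping.lookup u w * Poly_Mapping.lookup v w)"
    by (rule sum.mono_neutral_right) (auto simp: in_keys_iff)
  finally show ?thesis .
qed

lemma monomial_form_linear:
  "monomial_form u 0 = 0"
  "monomial_form u (v - v') = monomial_form u v - monomial_form u v'"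
  "monomial_form u (scale c (monomial w)) = c * Poly_Mapping.lookup u w"
  by (auto simp: monomial_form_def lookup_minus lookup_scale right_diff_distrib sum_subtractf lookup_single when_def
      in_keys_iff if_distrib cong: if_cong)

text \<open>
  The form pairs \<open>p yz + q zy + r xx\<close> with \<open>r yz - p xx\<close> to \<open>p r - r p = 0\<close>, and likewise for the others.
\<close>

lemma dual_relator_in_perp: "dual_relator \<xi> j \<in> quadratic_perp (sklyanin_relations \<xi>)"
proof -
  have "monomial_form r (dual_relator \<xi> j) = 0" if "r \<in> sklyanin_relations \<xi>" for r
    using that unfolding sklyanin_relations_def
  proof (rule tensor.span_induct)
    show "tensor.subspace {r. monomial_form r (dual_relator \<xi> j) = 0}"
      by (auto simp: tensor.subspace_def monomial_form_right lookup_add lookup_scale distrib_right sum.distrib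
          mult.assoc simp flip: sum_distrib_left)
  qed (cases "(\<xi>, j)" rule: dual_relator.cases;
     auto simp: monomial_form_linear lookup_add lookup_scale lookup_single when_def)
  then show ?thesis
    by (simp add: quadratic_perp_def dual_relator_quadratic)
qed

section \<open>Nilpotency at a special point\<close>

text \<open>
  The algebra at the point that is perturbed. The two cases for \<open>b\<close> together cover all
  characteristics. In the comments words are written without the multiplication sign.
\<close>

locale special_sklyanin_ring =
  fixes x y z b :: "'a::ring_1"
  assumes xx: "x * x = z * y"
    and yy: "y * y = x * z"
    and zz: "z * z = x * y + b * (y * x)"
    and sign: "(b = 1 \<and> (\<exists>i. i * 3 = (1 :: 'a))) \<or> (b = - 1 \<and> (3 :: 'a) = 0)"
begin

text \<open>
  The element \<open>t = xxx = yyy\<close> is central. Long words vanish because words of a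
  certain length are multiples of \<open>t\<close> and because \<open>t\<close> is nilpotent.
\<close>

definition t :: 'a where "t = x * (x * x)"

lemma b_commute:
  "x * b = b * x" "y * b = b * y" "z * b = b * z" "t * b = b * t"
  "x * (b * u) = b * (x * u)" "y * (b * u) = b * (y * u)" "z * (b * u) = b * (z * u)" "t * (b * u) = b * (t * u)"
  using sign by auto

lemma b_square: "b * b = 1" "b * (b * u) = u"
  using sign by auto

lemmas b_rules = b_commute b_square distrib_left distrib_right mult.assoc

lemma t_eq_y: "t = y * (y * y)"
  unfolding t_def by (metis mult.assoc xx yy)

text \<open>
  The two ways of bracketing \<open>zzz\<close> agree. The next lemmas come in the same way from
  \<open>xzz = yyz\<close>, \<open>zzy = zxx\<close> and from the two expressions of \<open>t z\<close>.
\<close>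

lemma zxy: "z * (x * y) = x * (y * z)"
proof -
  have "z * (x * y) + b * t = z * (z * z)"
    by (simp add: zz b_rules t_eq_y flip: xx) (metis t_eq_y t_def mult.assoc xx)
  also have "\<dots> = (z * z) * z"
    by (simp add: mult.assoc)
  also have "\<dots> = x * (y * z) + b * t"
    by (simp add: zz b_rules t_eq_y yy)
  finally show ?thesis
    by simp
qed

lemma t_z: "t * z = x * (x * (y * y))"
  by (simp add: t_def mult.assoc yy)

lemma t_commute_x: "x * t = t * x" and t_commute_y: "y * t = t * y"
  by (simp_all add: t_def mult.assoc) (metis t_def t_eq_y mult.assoc)

lemma t_commute_z: "z * t = t * z"
proof -
  have "z * t = (z * y) * (y * y)"
    by (simp add: t_eq_y mult.assoc)
  then show ?thesis
    by (simp add: t_z mult.assoc flip: xx)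
qed

lemma yyz: "y * (y * z) = x * (x * y) + b * (x * (y * x))"
proof -
  have "y * (y * z) = x * (z * z)"
    by (metis mult.assoc yy)
  then show ?thesis
    by (simp add: zz b_rules)
qed

lemma zxx: "z * (x * x) = x * (y * y) + b * (y * (x * y))"
proof -
  have "z * (x * x) = (z * z) * y"
    by (metis mult.assoc xx)
  then show ?thesis
    by (simp add: zz b_rules)
qed

lemma t_z_eq: "t * z = x * (y * (y * x)) + b * (y * (x * (y * x)))"
proof -
  have "z * t = (z * (x * x)) * x"
    by (simp add: t_def mult.assoc)
  then have "t * z = (z * (x * x)) * x"
    by (simp add: t_commute_z)
  then show ?thesis
    unfolding zxx by (simp add: b_rules)
qed

lemma xyyx: "x * (y * (y * x)) = y * (x * (x * y))"
proof -
  have "t * z = y * (y * (y * z))"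
    by (simp add: t_eq_y mult.assoc)
  then have "t * z = y * (x * (x * y)) + b * (y * (x * (y * x)))"
    by (simp add: yyz b_rules)
  then show ?thesis
    using t_z_eq by simp
qed

lemma yyxx: "y * (y * (x * x)) = t * z + b * (x * (y * (x * y)))"
proof -
  have "y * (y * (x * x)) = (y * (y * z)) * y"
    by (simp add: xx mult.assoc)
  then show ?thesis
    unfolding yyz by (simp add: b_rules t_z)
qed

lemma t_commute_letters:
  "x * (t * w) = t * (x * w)" "y * (t * w) = t * (y * w)" "z * (t * w) = t * (z * w)"
  by (simp_all add: t_commute_x t_commute_y t_commute_z flip: mult.assoc)

lemma xyyxy: "x * (y * (y * (x * y))) = t * (y * z)"
proof -
  have "x * (y * (y * (x * y))) = (x * (y * (y * x))) * y"
    by (simp add: mult.assoc)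
  also have "\<dots> = y * (x * (x * (y * y)))"
    by (simp add: xyyx mult.assoc)
  finally show ?thesis
    by (simp add: t_commute_letters flip: t_z)
qed

text \<open>
  Reduce \<open>zxyy\<close> once by \<open>zxy = xyz\<close> and once by \<open>yy = xz\<close>.
\<close>

lemma yxyz: "b * (y * (x * (y * z))) = x * (y * (x * x)) - t * y - b * (x * (x * (y * x)))"
proof -
  have "x * (y * (x * x)) = (x * (y * z)) * y"
    by (simp add: xx mult.assoc)
  also have "\<dots> = z * (x * (y * y))"
    by (simp add: mult.assoc flip: zxy)
  also have "\<dots> = (z * (x * x)) * z"
    by (simp add: yy mult.assoc)
  also have "\<dots> = x * (y * (y * z)) + b * (y * (x * (y * z)))"
    unfolding zxx by (simp add: b_rules)
  also have "\<dots> = t * y + b * (x * (x * (y * x))) + b * (y * (x * (y * z)))"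
    by (simp add: yyz b_rules t_def)
  finally show ?thesis
    by simp
qed

lemma yxyyx: "y * (x * (y * (y * x))) = t * (x * x) + b * (x * (y * (x * (y * y))))"
proof -
  have "y * (x * (y * (y * x))) = (y * (y * (x * x))) * y"
    by (simp add: xyyx mult.assoc)
  also have "\<dots> = t * (z * y) + b * (x * (y * (x * (y * y))))"
    unfolding yyxx by (simp add: b_rules)
  finally show ?thesis
    by (simp add: xx)
qed

text \<open>
  The source of the nilpotency of \<open>t\<close>: multiply the previous expression of \<open>yxyz\<close> by \<open>z\<close> on the
  left and reduce both sides. For \<open>b = 1\<close> the left-hand side vanishes and \<open>3 t xx = 0\<close> remains.
\<close>

lemma xyxyy_relation: "x * (y * (x * (y * y))) - b * (x * (y * (x * (y * y)))) = 2 * (t * (x * x)) + b * (t * (x * x))"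
proof -
  let ?u = "x * (y * (x * (y * y)))" and ?v = "t * (x * x)"
  have "z * (y * (x * (y * z))) = x * x * (x * (y * z))"
    unfolding xx by (simp add: mult.assoc)
  then have 1: "z * (y * (x * (y * z))) = t * (y * z)"
    by (simp add: t_def mult.assoc)
  have "z * (x * (y * (x * x))) = (z * (x * y)) * (x * x)"
    by (simp add: mult.assoc)
  also have "\<dots> = x * (y * (z * (x * x)))"
    unfolding zxy by (simp add: mult.assoc)
  also have "\<dots> = ?u + b * (t * (y * z))"
    by (simp add: zxx b_rules xyyxy)
  finally have 2: "z * (x * (y * (x * x))) = ?u + b * (t * (y * z))" .
  have 3: "z * (t * y) = ?v"
    by (simp add: t_commute_letters flip: xx)
  have "z * (x * (x * (y * x))) = (z * (x * x)) * (y * x)"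
    by (simp add: mult.assoc)
  also have "\<dots> = x * (y * (y * y)) * x + b * (y * (x * (y * (y * x))))"
    unfolding zxx by (simp add: b_rules)
  also have "x * (y * (y * y)) * x = ?v"
    by (simp add: t_commute_x mult.assoc flip: t_eq_y)
  also have "b * (y * (x * (y * (y * x)))) = b * ?v + ?u"
    by (simp add: yxyyx b_rules)
  finally have 4: "z * (x * (x * (y * x))) = ?v + (b * ?v + ?u)" .
  have "z * (b * (y * (x * (y * z)))) = z * (x * (y * (x * x)) - t * y - b * (x * (x * (y * x))))"
    by (simp only: yxyz)
  then have "b * (t * (y * z)) = ?u + b * (t * (y * z)) - ?v - (b * ?v + ?v + b * ?u)"
    by (simp add: right_diff_distrib b_commute 1 2 3 4 distrib_left b_square add.assoc)
  then show ?thesis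
    by (simp add: algebra_simps mult_2)
qed

text \<open>
  For \<open>b = 1\<close> already \<open>t xx = 0\<close>, so that \<open>t t = t xxx = 0\<close>. For \<open>b = -1\<close> and \<open>3 = 0\<close> the relation
  becomes \<open>xyxyy = - t xx\<close>. Multiplication by \<open>y\<close> on the right gives \<open>t xyx = - t xxy\<close>. Multiplying this
  by \<open>x\<close> from both sides gives \<open>t xyxx = - t xxyx = t t y\<close>, so \<open>t t xy = t t yx\<close>. Together these
  show that \<open>t t xxy\<close> is its own negative, hence zero. Then \<open>t t t y = 0\<close> and finally
  \<open>t t t t = t t t yyy = 0\<close>.
\<close>

lemma t_power_4: "t ^ 4 = 0"
  using sign
proof (elim disjE conjE exE)
  fix i :: 'a
  assume "b = 1" and i: "i * 3 = 1"
  then have "2 * (t * (x * x)) + t * (x * x) = 0"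
    using xyxyy_relation by simp
  then have "3 * (t * (x * x)) = 0"
    using distrib_right[of 2 1 "t * (x * x)"] by simp
  then have "t * (x * x) = 0"
    by (metis i mult.assoc mult_1 mult_zero_right)
  then have "t * (x * x) * x = 0"
    by simp
  then have "t * t = 0"
    by (simp add: t_def mult.assoc)
  then show ?thesis
    by (simp add: power4_eq_xxxx)
next
  assume b: "b = - 1" and three: "(3 :: 'a) = 0"
  have halve: "u = 0" if "u + u = 0" for u :: 'a
  proof -
    have "u + u + u = 3 * u"
      using distrib_right[of 2 1 u] by (simp add: mult_2)
    then show ?thesis
      using that three by simp
  qed
  have "x * (y * (x * (y * y))) + t * (x * x) = 0" (is "?u + ?v = 0")
  proof (rule halve)
    have "?u + ?u = ?v"
      using xyxyy_relation by (simp add: b mult_2)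
    have "?u + ?v + (?u + ?v) = (?u + ?u) + 2 * ?v"
      by (simp add: mult_2 add_ac)
    also have "\<dots> = 3 * ?v"
      unfolding \<open>?u + ?u = ?v\<close> using distrib_right[of 1 2 ?v] by simp
    finally show "?u + ?v + (?u + ?v) = 0"
      using three by simp
  qed
  then have "x * (y * (x * (y * y))) = - (t * (x * x))"
    by (simp add: eq_neg_iff_add_eq_0)
  then have "x * (y * (x * (y * y))) * y = - (t * (x * x)) * y"
    by simp
  then have 1: "t * (x * (y * x)) = - (t * (x * (x * y)))"
    by (simp add: mult.assoc t_commute_letters t_commute_x t_commute_y flip: t_eq_y)
  then have "x * (t * (x * (y * x))) = - (x * (t * (x * (x * y))))"
    by simp
  then have "t * (x * (x * (y * x))) = - (t * (t * y))"
    by (simp add: t_commute_letters) (simp add: t_def mult.assoc)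
  moreover have "t * (x * (y * x)) * x = - (t * (x * (x * y))) * x"
    using 1 by simp
  ultimately have "t * (x * (y * (x * x))) = t * (t * y)"
    by (simp add: mult.assoc)
  then have "t * (x * (y * (x * x))) * x = t * (t * y) * x"
    by simp
  then have "t * (t * (x * y)) = t * (t * (y * x))"
    by (simp add: mult.assoc t_commute_letters t_commute_x t_commute_y flip: t_def)
  then have "x * (t * (t * (x * y))) = x * (t * (t * (y * x)))"
    by simp
  then have "t * (t * (x * (x * y))) = t * (t * (x * (y * x)))"
    by (simp add: t_commute_letters)
  then have "t * (t * (x * (x * y))) = 0"
    using 1 by (intro halve[of "t * (t * (x * (x * y)))"]) (simp add: eq_neg_iff_add_eq_0)
  then have "x * (t * (t * (x * (x * y)))) = 0"
    by simp
  then have "t * (t * (t * y)) = 0"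
    by (simp add: t_commute_letters) (simp add: t_def mult.assoc)
  then have "t * (t * (t * y)) * (y * y) = 0"
    by simp
  then show ?thesis
    by (simp add: power4_eq_xxxx mult.assoc flip: t_eq_y)
qed

definition t_dvd :: "'a \<Rightarrow> bool" where "t_dvd u \<longleftrightarrow> (\<exists>v. u = t * v)"

lemma t_dvd_X: "t_dvd (t * v)"
  by (auto simp: t_dvd_def)

lemma t_dvd_right: "t_dvd u \<Longrightarrow> t_dvd (u * v)"
  by (auto simp: t_dvd_def mult.assoc)

lemma t_dvd_left: "t_dvd u \<Longrightarrow> c * t = t * c \<Longrightarrow> t_dvd (c * u)"
  unfolding t_dvd_def by (metis mult.assoc)

lemma t_dvd_add: "t_dvd u \<Longrightarrow> t_dvd v \<Longrightarrow> t_dvd (u + v)" and t_dvd_minus: "t_dvd u \<Longrightarrow> t_dvd (- u)"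
  unfolding t_dvd_def by (metis distrib_left mult_minus_right)+

lemma t_dvd_b: "t_dvd (b * u) \<longleftrightarrow> t_dvd u"
  by (metis t_dvd_left b_commute(4) b_square(2))

lemma t_dvd_letter: "t_dvd w \<Longrightarrow> t_dvd (x * w)" "t_dvd w \<Longrightarrow> t_dvd (y * w)" "t_dvd w \<Longrightarrow> t_dvd (z * w)"
  by (simp_all add: t_dvd_left t_commute_x t_commute_y t_commute_z)

text \<open>
  Modulo \<open>t\<close> the factor \<open>p\<close> equals \<open>b p'\<close> up to sign, and \<open>b\<close> is invertible.
\<close>

lemma t_dvd_swap:
  assumes "c * t = t * c" and "p = t * q + b * p' \<or> t * q = p + b * p'"
  shows "t_dvd (c * (p * w)) \<longleftrightarrow> t_dvd (c * (p' * w))"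
proof -
  have t_dvd: "t_dvd (c * (t * q * w))"
    by (metis t_dvd_X t_dvd_left assms(1) mult.assoc)
  have cb: "c * (b * u) = b * (c * u)" for u
    using sign by auto
  from assms(2) show ?thesis
  proof
    assume "p = t * q + b * p'"
    then have "c * (p * w) = c * (t * q * w) + b * (c * (p' * w))"
      by (simp add: algebra_simps cb)
    then show ?thesis
      using t_dvd t_dvd_add t_dvd_minus t_dvd_b by (metis add_minus_cancel)
  next
    assume "t * q = p + b * p'"
    then have "c * (t * q * w) = c * (p * w) + b * (c * (p' * w))"
      by (simp add: algebra_simps cb)
    then show ?thesis
      using t_dvd t_dvd_add t_dvd_minus t_dvd_b by (metis add_minus_cancel add.commute)
  qed
qed

lemma t_dvd_yyxx: "c * t = t * c \<Longrightarrow> t_dvd (c * (y * (y * (x * (x * w))))) \<longleftrightarrow> t_dvd (c * (x * (y * (x * (y * w)))))"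
  using t_dvd_swap[OF _ disjI1[OF yyxx], of c w] by (simp add: mult.assoc)

lemma t_dvd_xyyx: "c * t = t * c \<Longrightarrow> t_dvd (c * (x * (y * (y * (x * w))))) \<longleftrightarrow> t_dvd (c * (y * (x * (y * (x * w)))))"
  using t_dvd_swap[OF _ disjI2[OF t_z_eq], of c w] by (simp add: mult.assoc)

lemma xyyx_tail: "x * (y * (y * (x * w))) = y * (x * (x * (y * w)))"
proof -
  have "x * (y * (y * x)) * w = y * (x * (x * y)) * w"
    by (simp only: xyyx)
  then show ?thesis
    by (simp add: mult.assoc)
qed

text \<open>
  The trailing factor \<open>w\<close> makes these rules applicable inside longer words.
\<close>

lemma t_dvd_cubes: "t_dvd (x * (x * (x * w)))" "t_dvd (y * (y * (y * w)))" "t_dvd (x * (x * (y * (y * w))))"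
proof -
  show "t_dvd (x * (x * (x * w)))"
    using t_dvd_X[of w] unfolding t_def by (simp add: mult.assoc)
  show "t_dvd (y * (y * (y * w)))"
    using t_dvd_X[of w] unfolding t_eq_y by (simp add: mult.assoc)
  have "t_dvd (t * z * w)"
    by (simp add: t_dvd_X mult.assoc)
  then show "t_dvd (x * (x * (y * (y * w))))"
    unfolding t_z by (simp add: mult.assoc)
qed

lemma t_dvd_5:
  "t_dvd (x * (y * (x * (x * (y * w)))))" "t_dvd (x * (y * (x * (y * (x * w)))))"
  "t_dvd (x * (y * (y * (x * (y * w)))))" "t_dvd (y * (x * (y * (x * (y * w)))))"
proof -
  show "t_dvd (x * (y * (x * (x * (y * w)))))"
    by (simp add: t_dvd_cubes flip: xyyx_tail)
  show "t_dvd (x * (y * (x * (y * (x * w)))))"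
    using t_dvd_xyyx[of x w] by (simp add: t_dvd_cubes t_commute_x)
  show "t_dvd (x * (y * (y * (x * (y * w)))))"
    by (simp add: xyyx_tail t_dvd_cubes t_dvd_letter)
  show "t_dvd (y * (x * (y * (x * (y * w)))))"
    using t_dvd_yyxx[of y w] by (simp add: t_dvd_cubes t_commute_y)
qed

text \<open>
  Modulo \<open>t\<close> one has \<open>xxx = yyy = xxyy = 0\<close>, \<open>yxxy = xyyx\<close>, and up to sign \<open>yyxx = xyxy\<close> and
  \<open>xyyx = yxyx\<close>. These are the words of length 6 in \<open>x\<close> and \<open>y\<close> that have none of the words treated
  before as a factor; the replacements lead from each of them to a word that has one.
\<close>

lemma t_dvd_6:
  "t_dvd (x * (y * (y * (x * (x * (y * w))))))"
  "t_dvd (x * (x * (y * (x * (y * (y * w))))))"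
  "t_dvd (x * (y * (x * (y * (y * (x * w))))))"
  "t_dvd (y * (x * (x * (y * (x * (x * w))))))"
  "t_dvd (y * (x * (x * (y * (x * (y * w))))))"
  "t_dvd (y * (x * (y * (y * (x * (x * w))))))"
  "t_dvd (y * (y * (x * (x * (y * (x * w))))))"
  "t_dvd (y * (y * (x * (y * (x * (x * w))))))"
  "t_dvd (y * (y * (x * (y * (y * (x * w))))))"
proof -
  show 1: "t_dvd (x * (y * (y * (x * (x * (y * w))))))" for w
    using t_dvd_xyyx[of 1 "x * (y * w)"] by (simp add: t_dvd_5 t_dvd_letter)
  show 2: "t_dvd (x * (x * (y * (x * (y * (y * w))))))"
    using t_dvd_yyxx[of x "y * w"] 1 by (simp add: t_commute_x)
  show 3: "t_dvd (x * (y * (x * (y * (y * (x * w))))))" for w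
    by (subst xyyx_tail) (rule 1)
  show "t_dvd (y * (x * (x * (y * (x * (x * w))))))"
    unfolding xyyx_tail[symmetric] by (simp add: t_dvd_cubes t_dvd_letter)
  show 4: "t_dvd (y * (x * (x * (y * (x * (y * w))))))" for w
    by (subst xyyx_tail[symmetric]) (rule 1)
  show 5: "t_dvd (y * (x * (y * (y * (x * (x * w))))))" for w
    using t_dvd_yyxx[of "y * x" w] 4
    by (simp add: mult.assoc t_commute_x t_commute_y t_commute_letters)
  show "t_dvd (y * (y * (x * (x * (y * (x * w))))))"
    using t_dvd_yyxx[of 1 "y * (x * w)"] 3 by simp
  show "t_dvd (y * (y * (x * (y * (x * (x * w))))))"
    using t_dvd_xyyx[of y "x * w"] 5 by (simp add: t_commute_y)
  show "t_dvd (y * (y * (x * (y * (y * (x * w))))))"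
    using t_dvd_xyyx[of "y * y" w]
    by (simp add: t_dvd_cubes mult.assoc t_commute_x t_commute_y t_commute_letters)
qed

lemma t_dvd_xy_word:
  assumes "set ws \<subseteq> {x, y}" and "length ws \<ge> 6"
  shows "t_dvd (prod_list ws)"
proof -
  from assms(2) obtain a1 a2 a3 a4 a5 a6 vs where "ws = a1 # a2 # a3 # a4 # a5 # a6 # vs"
    by (auto simp: Suc_le_length_iff numeral_eq_Suc)
  then show ?thesis
    using assms(1) by (auto simp: t_dvd_cubes t_dvd_5 t_dvd_6 t_dvd_letter)
qed

text \<open>
  The additive group generated by the words of length \<open>n\<close> in \<open>x\<close> and \<open>y\<close>. It is closed under
  multiplication by \<open>b\<close>, since \<open>b\<close> is a sign.
\<close>

inductive_set xy_span :: "nat \<Rightarrow> 'a set" for n where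
  word: "set ws \<subseteq> {x, y} \<Longrightarrow> length ws = n \<Longrightarrow> prod_list ws \<in> xy_span n"
| add: "p \<in> xy_span n \<Longrightarrow> q \<in> xy_span n \<Longrightarrow> p + q \<in> xy_span n"
| minus: "p \<in> xy_span n \<Longrightarrow> - p \<in> xy_span n"

lemma xy_span_zero: "0 \<in> xy_span n"
proof -
  have "prod_list (replicate n x) + - prod_list (replicate n x) \<in> xy_span n"
    by (intro xy_span.intros) auto
  then show ?thesis
    by simp
qed

lemma xy_span_b: "p \<in> xy_span n \<Longrightarrow> p * b \<in> xy_span n"
  using sign xy_span.minus by auto

lemma xy_span_word:
  assumes "p \<in> xy_span n" and "set vs \<subseteq> {x, y}"
  shows "p * prod_list vs \<in> xy_span (n + length vs)"
  using assms(1)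
proof induction
  case (word ws)
  then have "prod_list (ws @ vs) \<in> xy_span (n + length vs)"
    using assms(2) by (intro xy_span.word) auto
  then show ?case
    by simp
qed (auto simp: distrib_right intro: xy_span.intros)

lemma xy_span_letters:
  assumes "p \<in> xy_span n" "set vs \<subseteq> {x, y}" "length vs = k"
  shows "p * prod_list vs \<in> xy_span (n + k)"
  using xy_span_word[OF assms(1,2)] assms(3) by simp

lemma t_dvd_xy_span: "p \<in> xy_span n \<Longrightarrow> n \<ge> 6 \<Longrightarrow> t_dvd p"
  by (induction rule: xy_span.induct) (auto intro: t_dvd_xy_word t_dvd_add t_dvd_minus)

text \<open>
  Every word of length \<open>n + 2\<close> in the three letters can be written in this form: \<open>z\<close> can be moved
  to the right end, since each of \<open>zxx\<close>, \<open>zxy\<close>, \<open>zxz\<close>, \<open>zy\<close> and \<open>zz\<close> is a combination of words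
  in \<open>x\<close> and \<open>y\<close> followed by at most one \<open>z\<close>.
\<close>

definition normal_span :: "nat \<Rightarrow> 'a set" where
  "normal_span n = {p + q * z + r * (z * x) | p q r.
     p \<in> xy_span (n + 2) \<and> q \<in> xy_span (n + 1) \<and> r \<in> xy_span n}"

lemma zxz: "z * (x * z) = x * (x * y)"
  by (metis mult.assoc xx yy)

lemma normal_span_letter:
  assumes "u \<in> normal_span n" and "c \<in> {x, y, z}"
  shows "u * c \<in> normal_span (Suc n)"
proof -
  from assms(1) obtain p q r where u: "u = p + q * z + r * (z * x)"
    and p: "p \<in> xy_span (n + 2)" and q: "q \<in> xy_span (n + 1)" and r: "r \<in> xy_span n"
    by (auto simp: normal_span_def)
  have intro: "v \<in> normal_span (Suc n)"
    if "v = p' + q' * z + r' * (z * x)" "p' \<in> xy_span (n + 3)" "q' \<in> xy_span (n + 2)" "r' \<in> xy_span (n + 1)" for v p' q' r'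
    using that by (auto simp: normal_span_def eval_nat_numeral)
  from assms(2) consider "c = x" | "c = y" | "c = z"
    by auto
  then show ?thesis
  proof cases
    case 1
    have "r * (z * (x * x)) = r * (x * (y * y)) + r * b * (y * (x * y))"
      unfolding zxx by (simp add: distrib_left mult.assoc)
    then have eq: "u * c = (p * x + r * (x * (y * y)) + r * b * (y * (x * y))) + 0 * z + q * (z * x)"
      by (simp add: u 1 distrib_right mult.assoc add_ac)
    moreover have "p * x \<in> xy_span (n + 3)"
      using xy_span_letters[OF p, of "[x]"] by (simp add: eval_nat_numeral)
    moreover have "r * (x * (y * y)) \<in> xy_span (n + 3)"
      using xy_span_letters[OF r, of "[x, y, y]"] by (simp add: eval_nat_numeral)
    moreover have "r * b * (y * (x * y)) \<in> xy_span (n + 3)"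
      using xy_span_letters[OF xy_span_b[OF r], of "[y, x, y]"] by (simp add: eval_nat_numeral)
    ultimately show ?thesis
      using q by (intro intro[OF eq]) (auto intro: xy_span.add xy_span_zero)
  next
    case 2
    have eq: "u * c = (p * y + q * (x * x)) + (r * (x * y)) * z + 0 * (z * x)"
      by (simp add: u 2 distrib_right mult.assoc zxy) (simp flip: xx)
    moreover have "p * y \<in> xy_span (n + 3)"
      using xy_span_letters[OF p, of "[y]"] by (simp add: eval_nat_numeral)
    moreover have "q * (x * x) \<in> xy_span (n + 3)"
      using xy_span_letters[OF q, of "[x, x]"] by (simp add: eval_nat_numeral)
    moreover have "r * (x * y) \<in> xy_span (n + 2)"
      using xy_span_letters[OF r, of "[x, y]"] by (simp add: eval_nat_numeral)
    ultimately show ?thesis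
      by (intro intro[OF eq]) (auto intro: xy_span.add xy_span_zero)
  next
    case 3
    have "q * (z * z) = q * (x * y) + q * b * (y * x)"
      unfolding zz by (simp add: distrib_left mult.assoc)
    then have eq: "u * c = (q * (x * y) + q * b * (y * x) + r * (x * (x * y))) + p * z + 0 * (z * x)"
      by (simp add: u 3 distrib_right mult.assoc zxz add_ac)
    moreover have "q * (x * y) \<in> xy_span (n + 3)"
      using xy_span_letters[OF q, of "[x, y]"] by (simp add: eval_nat_numeral)
    moreover have "q * b * (y * x) \<in> xy_span (n + 3)"
      using xy_span_letters[OF xy_span_b[OF q], of "[y, x]"] by (simp add: eval_nat_numeral)
    moreover have "r * (x * (x * y)) \<in> xy_span (n + 3)"
      using xy_span_letters[OF r, of "[x, x, y]"] by (simp add: eval_nat_numeral)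
    ultimately show ?thesis
      using p by (intro intro[OF eq]) (auto intro: xy_span.add xy_span_zero)
  qed
qed

lemma normal_span_two_letters:
  assumes "c \<in> {x, y, z}" and "d \<in> {x, y, z}"
  shows "c * d \<in> normal_span 0"
proof -
  have word: "prod_list ws \<in> xy_span (length ws)" if "set ws \<subseteq> {x, y}" for ws
    using that by (intro xy_span.word) auto
  have xy: "c' * d' \<in> xy_span (Suc (Suc 0))" if "c' \<in> {x, y}" "d' \<in> {x, y}" for c' d'
    using word[of "[c', d']"] that by simp
  have intro: "v \<in> normal_span 0"
    if "v = p + q * z + r * (z * x)" "p \<in> xy_span (Suc (Suc 0))" "q \<in> xy_span (Suc 0)" "r \<in> xy_span 0" for v p q r
    using that by (auto simp: normal_span_def eval_nat_numeral)
  have *: "c' * d' \<in> normal_span 0" if "c' \<in> {x, y}" "d' \<in> {x, y}" for c' d'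
    using that by (intro intro[of _ "c' * d'" 0 0] xy xy_span_zero) auto
  have "y * z \<in> normal_span 0"
    using word[of "[y]"] by (intro intro[of _ 0 y 0] xy_span_zero) auto
  moreover have "z * x \<in> normal_span 0"
    using word[of "[]"] by (intro intro[of _ 0 0 1] xy_span_zero) auto
  moreover have "z * z \<in> normal_span 0"
  proof (intro intro[of _ "x * y + b * (y * x)" 0 0] xy_span_zero)
    have "b * (y * x) = y * x * b"
      by (simp add: b_rules)
    then show "x * y + b * (y * x) \<in> xy_span (Suc (Suc 0))"
      by (auto intro!: xy_span.add xy_span_b xy)
  qed (simp add: zz)
  moreover have "x * z \<in> normal_span 0" "z * y \<in> normal_span 0"
    using *[of x x] *[of y y] by (simp_all add: xx yy)
  ultimately show ?thesis
    using assms * by blast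
qed

lemma word_normal_span:
  assumes "set ws \<subseteq> {x, y, z}" and "length ws = n + 2"
  shows "prod_list ws \<in> normal_span n"
  using assms
proof (induction n arbitrary: ws)
  case 0
  then obtain c d where "ws = [c, d]"
    by (auto simp: length_Suc_conv eval_nat_numeral)
  then show ?case
    using 0 normal_span_two_letters[of c d] by auto
next
  case (Suc n)
  then obtain vs c where ws: "ws = vs @ [c]"
    by (cases ws rule: rev_cases) auto
  then have "prod_list vs * c \<in> normal_span (Suc n)"
    using Suc by (intro normal_span_letter) auto
  then show ?case
    by (simp add: ws)
qed

text \<open>
  In the normal form the factors in \<open>x\<close> and \<open>y\<close> have lengths 8, 7 and 6.
\<close>

lemma t_dvd_word_8:
  assumes "set ws \<subseteq> {x, y, z}" and "length ws = 8"
  shows "t_dvd (prod_list ws)"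
proof -
  have "prod_list ws \<in> normal_span 6"
    using assms by (intro word_normal_span) auto
  then obtain p q r where "prod_list ws = p + q * z + r * (z * x)"
    and "p \<in> xy_span 8" "q \<in> xy_span 7" "r \<in> xy_span 6"
    by (auto simp: normal_span_def)
  then show ?thesis
    by (auto intro!: t_dvd_add t_dvd_right intro: t_dvd_xy_span)
qed

lemma t_commute_word: "set ws \<subseteq> {x, y, z} \<Longrightarrow> prod_list ws * t = t * prod_list ws"
  by (induction ws) (auto simp: mult.assoc t_commute_letters)

text \<open>
  Each block of 8 letters contributes a factor \<open>t\<close>, which commutes with the letters before it. The
  blocks are removed from the right, since the cofactor \<open>v\<close> of \<open>t\<close> need not commute with
  \<open>t\<close>.
\<close>

lemma t_power_divides:
  assumes "set ws \<subseteq> {x, y, z}" and "length ws = 8 * k"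
  shows "\<exists>v. prod_list ws = t ^ k * v"
  using assms
proof (induction k arbitrary: ws)
  case 0
  then show ?case
    by simp
next
  case (Suc k)
  define us vs where "us = take (8 * k) ws" and "vs = drop (8 * k) ws"
  have sets: "set us \<subseteq> {x, y, z}" "set vs \<subseteq> {x, y, z}"
    using Suc.prems(1) set_take_subset[of "8 * k" ws] set_drop_subset[of "8 * k" ws]
    by (auto simp: us_def vs_def)
  have "t_dvd (prod_list vs)"
    using Suc.prems sets by (intro t_dvd_word_8) (auto simp: vs_def)
  then obtain v where v: "prod_list vs = t * v"
    by (auto simp: t_dvd_def)
  obtain u where u: "prod_list us = t ^ k * u"
    using Suc.IH[of us] Suc.prems sets by (auto simp: us_def)
  have "prod_list ws = prod_list us * prod_list vs"
    by (simp add: us_def vs_def flip: prod_list.append)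
  also have "\<dots> = t * prod_list us * v"
    by (simp add: v t_commute_word[OF sets(1)] flip: mult.assoc)
  also have "\<dots> = t ^ Suc k * (u * v)"
    by (simp add: u mult.assoc)
  finally show ?case
    by blast
qed

lemma word_32_eq_0:
  assumes "set ws \<subseteq> {x, y, z}" and "length ws = 32"
  shows "prod_list ws = 0"
  using t_power_divides[of ws 4] assms t_power_4 by auto

end

section \<open>The algebra at the special point\<close>

text \<open>
  For sign \<open>1\<close> the nilpotency of \<open>t\<close> results from a division by 3; sign \<open>-1\<close> serves in
  characteristic 3.
\<close>

definition special_sign :: "'k::field" where
  "special_sign = (if (3 :: 'k) = 0 then - 1 else 1)"

text \<open>
  At this point the relations read \<open>xx = zy\<close>, \<open>yy = xz\<close> and \<open>zz = xy + b yx\<close>, where \<open>b\<close> is the sign.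
  All coordinates are \<open>0\<close> or \<open>\<plusminus>1\<close>, as they have to be over the field with two elements.
\<close>

definition special_point :: "'k::field ^ 9" where
  "special_point = (\<chi> i. if i \<in> {3, 4, 5} then - 1 else if i = 6 then - special_sign
     else if i \<in> {7, 8, 9} then 1 else 0)"

lemma special_point_coordinates:
  "special_point $ 1 = 0" "special_point $ 2 = 0" "special_point $ 3 = - 1"
  "special_point $ 4 = - 1" "special_point $ 5 = - 1" "special_point $ 6 = - special_sign"
  "special_point $ 7 = 1" "special_point $ 8 = 1" "special_point $ 9 = 1"
  by (simp_all add: special_point_def)

lemma two_sided_span_no_constant:
  fixes g :: "'j \<Rightarrow> ('g::finite, 'k::field) tensor"
  assumes quad: "\<And>j. g j \<in> quadratic_tensors" and "t \<in> two_sided_span (range g)"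
  shows "Poly_Mapping.lookup t [] = 0"
  using assms(2)
proof (induction rule: two_sided_span_induct)
  case (generator u g' v)
  then obtain j where "g' = g j"
    by blast
  then show ?case
    using keys_multiple[OF quad, of u j v] by (auto simp: in_keys_iff)
qed (simp_all add: lookup_add lookup_scale)

abbreviation special_ideal :: "(gen, 'k::field) tensor set" where
  "special_ideal \<equiv> two_sided_span (range (sklyanin_relator special_point))"

text \<open>
  The identities of \<^locale>\<open>special_sklyanin_ring\<close> are equations in a ring. Making the quotient by the
  ideal a type of class \<^class>\<open>ring_1\<close> turns them into statements about membership in the ideal.
\<close>

quotient_type (overloaded) 'k special_algebra = "(gen, 'k::field) tensor" / "\<lambda>s t. s - t \<in> special_ideal"
proof (rule equivpI)
  show "reflp (\<lambda>s t :: (gen, 'k) tensor. s - t \<in> special_ideal)"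
    by (simp add: reflp_def two_sided_span_zero)
  show "symp (\<lambda>s t :: (gen, 'k) tensor. s - t \<in> special_ideal)"
    by (intro sympI) (use two_sided_span_diff[OF two_sided_span_zero] in fastforce)
  show "transp (\<lambda>s t :: (gen, 'k) tensor. s - t \<in> special_ideal)"
    by (intro transpI) (use two_sided_span_add in fastforce)
qed

instantiation special_algebra :: (field) ring_1
begin

lift_definition zero_special_algebra :: "'a special_algebra" is 0 .
lift_definition one_special_algebra :: "'a special_algebra" is 1 .
lift_definition plus_special_algebra :: "'a special_algebra \<Rightarrow> 'a special_algebra \<Rightarrow> 'a special_algebra" is "(+)"
  using two_sided_span_add by (metis add_diff_add)
lift_definition minus_special_algebra :: "'a special_algebra \<Rightarrow> 'a special_algebra \<Rightarrow> 'a special_algebra" is "(-)"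
proof -
  fix s s' t t' :: "(gen, 'a) tensor"
  assume "s - s' \<in> special_ideal" "t - t' \<in> special_ideal"
  then have "s - s' - (t - t') \<in> special_ideal"
    by (rule two_sided_span_diff)
  then show "s - t - (s' - t') \<in> special_ideal"
    by (simp add: algebra_simps)
qed
lift_definition uminus_special_algebra :: "'a special_algebra \<Rightarrow> 'a special_algebra" is uminus
proof -
  fix s s' :: "(gen, 'a) tensor"
  assume "s - s' \<in> special_ideal"
  then have "0 - (s - s') \<in> special_ideal"
    by (rule two_sided_span_diff[OF two_sided_span_zero])
  moreover have "- s - - s' = 0 - (s - s')"
    by simp
  ultimately show "- s - - s' \<in> special_ideal"
    by (simp only:)
qed
lift_definition times_special_algebra :: "'a special_algebra \<Rightarrow> 'a special_algebra \<Rightarrow> 'a special_algebra" is "(*)"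
proof -
  fix s s' t t' :: "(gen, 'a) tensor"
  assume "s - s' \<in> special_ideal" "t - t' \<in> special_ideal"
  then have "(s - s') * t + s' * (t - t') \<in> special_ideal"
    by (intro two_sided_span_add two_sided_span_mult)
  then show "s * t - s' * t' \<in> special_ideal"
    by (simp add: algebra_simps)
qed

instance
proof
  fix a b c :: "'a special_algebra"
  show "a + b + c = a + (b + c)"
    by transfer (simp add: add.assoc two_sided_span_zero)
  show "a + b = b + a"
    by transfer (simp add: add.commute two_sided_span_zero)
  show "0 + a = a"
    by transfer (simp add: two_sided_span_zero)
  show "- a + a = 0"
    by transfer (simp add: two_sided_span_zero)
  show "a - b = a + - b"
    by transfer (simp add: two_sided_span_zero)
  show "a * b * c = a * (b * c)"
    by transfer (simp add: mult.assoc two_sided_span_zero)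
  show "1 * a = a" "a * 1 = a"
    by (transfer, simp add: two_sided_span_zero)+
  show "(a + b) * c = a * c + b * c" "a * (b + c) = a * b + a * c"
    by (transfer, simp add: distrib_left distrib_right two_sided_span_zero)+
  show "(0 :: 'a special_algebra) \<noteq> 1"
  proof (transfer, rule notI)
    assume "(0 :: (gen, 'a) tensor) - 1 \<in> special_ideal"
    then have "Poly_Mapping.lookup (0 - 1 :: (gen, 'a) tensor) [] = 0"
      by (rule two_sided_span_no_constant[OF sklyanin_relator_quadratic])
    then show False
      by (simp add: lookup_minus flip: monomial_Nil)
  qed
qed

end

abbreviation special_class :: "(gen, 'k::field) tensor \<Rightarrow> 'k special_algebra" where
  "special_class \<equiv> abs_special_algebra"

lemma special_class_hom:
  "special_class 0 = 0" "special_class 1 = 1" "special_class (s * t) = special_class s * special_class t"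
  "special_class (s + t) = special_class s + special_class t" "special_class (- s) = - special_class s"
  by (simp_all add: zero_special_algebra.abs_eq one_special_algebra.abs_eq times_special_algebra.abs_eq
      plus_special_algebra.abs_eq uminus_special_algebra.abs_eq)

lemmas special_class_eq_iff = special_algebra.abs_eq_iff

lemma special_class_word:
  "(special_class (monomial w) :: 'k::field special_algebra) = prod_list (map (\<lambda>g. special_class (monomial [g])) w)"
proof (induction w)
  case Nil
  then show ?case
    by (simp add: monomial_Nil special_class_hom)
next
  case (Cons g w)
  have "(special_class (monomial (g # w)) :: 'k special_algebra) = special_class (monomial [g] * monomial w)"
    by (simp add: monomial_mult)
  then show ?case
    by (simp add: special_class_hom(3) Cons)
qed

lemma special_algebra_ring:
  "special_sklyanin_ring (special_class (monomial [gx])) (special_class (monomial [gy]))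
     (special_class (monomial [gz])) (special_class (Poly_Mapping.single [] (special_sign :: 'k::field)))"
proof
  have relator: "sklyanin_relator special_point j \<in> special_ideal" for j
    by (simp add: two_sided_span_superset)
  let ?x = "monomial [gx] :: (gen, 'k) tensor" and ?y = "monomial [gy] :: (gen, 'k) tensor"
    and ?z = "monomial [gz] :: (gen, 'k) tensor"
  have "?x * ?x - ?z * ?y \<in> special_ideal"
    using relator[of gx] by (simp add: special_point_coordinates tensor.scale_minus_left monomial_mult)
  then show "special_class ?x * special_class ?x = special_class ?z * special_class ?y"
    by (simp add: special_class_eq_iff flip: special_class_hom(3,4))
  have "?y * ?y - ?x * ?z \<in> special_ideal"
    using relator[of gy] by (simp add: special_point_coordinates tensor.scale_minus_left monomial_mult)
  then show "special_class ?y * special_class ?y = special_class ?x * special_class ?z"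
    by (simp add: special_class_eq_iff flip: special_class_hom(3,4))
  have "?z * ?z - (?x * ?y + Poly_Mapping.single [] special_sign * (?y * ?x)) \<in> special_ideal"
    using relator[of gz]
    by (simp add: special_point_coordinates tensor.scale_minus_left monomial_mult algebra_simps flip: scale_def)
  then show "special_class ?z * special_class ?z = special_class ?x * special_class ?y
      + special_class (Poly_Mapping.single [] special_sign) * (special_class ?y * special_class ?x)"
    by (simp add: special_class_eq_iff flip: special_class_hom(3,4))
  let ?h = "\<lambda>c :: 'k. special_class (Poly_Mapping.single [] c :: (gen, 'k) tensor)"
  have one: "?h 1 = 1"
    by (simp add: monomial_Nil special_class_hom)
  have "?h 3 = ?h (1 + 1 + 1)"
    by simp
  also have "\<dots> = 1 + 1 + 1"
    by (simp only: single_add special_class_hom one)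
  finally have three: "?h 3 = 3"
    by simp
  show "(?h special_sign = 1 \<and> (\<exists>i. i * 3 = (1 :: 'k special_algebra))) \<or> (?h special_sign = - 1 \<and> (3 :: 'k special_algebra) = 0)"
  proof (cases "(3 :: 'k) = 0")
    case True
    then have "(3 :: 'k special_algebra) = 0"
      unfolding three[symmetric] by (simp add: special_class_hom(1))
    moreover have "?h special_sign = - 1"
      using True one by (simp add: special_sign_def single_uminus special_class_hom)
    ultimately show ?thesis
      by blast
  next
    case False
    have "?h (inverse 3) * 3 = ?h (inverse 3 * 3)"
      by (simp add: mult_single plus_list_def flip: three special_class_hom(3))
    then have "?h (inverse 3) * 3 = 1"
      using False one by simp
    then show ?thesis
      using False one by (auto simp: special_sign_def)
  qed
qed

lemma word_32_in_special_ideal: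
  assumes "length w = 32"
  shows "monomial w \<in> (special_ideal :: (gen, 'k::field) tensor set)"
proof -
  let ?c = "\<lambda>g. special_class (monomial [g]) :: 'k special_algebra"
  have "?c g \<in> {?c gx, ?c gy, ?c gz}" for g
    by (cases g) simp_all
  then have "set (map ?c w) \<subseteq> {?c gx, ?c gy, ?c gz}"
    unfolding set_map by (rule image_subsetI)
  then have "prod_list (map ?c w) = 0"
    by (rule special_sklyanin_ring.word_32_eq_0[OF special_algebra_ring]) (simp add: assms)
  then have "special_class (monomial w) = (special_class 0 :: 'k special_algebra)"
    by (subst special_class_word) (simp add: special_class_hom(1))
  then show ?thesis
    by (simp add: special_class_eq_iff)
qed

section \<open>The dual algebra at the special point\<close>

text \<open>
  If \<open>a\<close> equals a nonzero multiple of \<open>b\<close> modulo the ideal, then one may be replaced by the other inside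
  a word when asking whether the word is in the ideal.
\<close>

lemma two_sided_span_exchange:
  fixes G :: "('g, 'k::field) tensor set"
  assumes "monomial a - scale c (monomial b) \<in> two_sided_span G" and "c \<noteq> 0"
  shows "monomial (u @ a @ v) \<in> two_sided_span G \<longleftrightarrow> monomial (u @ b @ v) \<in> two_sided_span G"
proof -
  let ?a = "monomial (u @ a @ v) :: ('g, 'k) tensor" and ?b = "monomial (u @ b @ v) :: ('g, 'k) tensor"
  have "monomial u * (monomial a - scale c (monomial b)) * monomial v \<in> two_sided_span G"
    using assms(1) by (intro two_sided_span_mult)
  then have diff: "?a - scale c ?b \<in> two_sided_span G"
    by (simp add: left_diff_distrib right_diff_distrib scale_mult_left scale_mult_right monomial_mult)
  show ?thesis
  proof
    assume "?b \<in> two_sided_span G"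
    from two_sided_span_add[OF diff two_sided_span_scale[OF this, of c]]
    show "?a \<in> two_sided_span G"
      by simp
  next
    assume "?a \<in> two_sided_span G"
    from two_sided_span_scale[OF two_sided_span_diff[OF this diff], of "inverse c"]
    show "?b \<in> two_sided_span G"
      using \<open>c \<noteq> 0\<close> by simp
  qed
qed

text \<open>
  In the dual algebra \<open>yz = zx = 0\<close>, while \<open>zy, xz, xy, yx\<close> are nonzero multiples of \<open>xx, yy, zz, zz\<close>.
  Hence \<open>xyz\<close> gives \<open>zzz = 0\<close>, then \<open>zyx\<close> gives \<open>xxx = 0\<close> and \<open>xzy\<close> gives \<open>yyy = 0\<close>. A
  word such as \<open>xxy\<close> is equivalent to \<open>xzz\<close> and so to \<open>yyz\<close>, which contains \<open>yz\<close>.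
\<close>

lemma word_3_in_special_dual_ideal:
  assumes "length w = 3"
  shows "monomial w \<in> two_sided_span (range (dual_relator (special_point :: 'k::field ^ 9)))"
proof -
  let ?I = "two_sided_span (range (dual_relator (special_point :: 'k ^ 9)))"
  define D where "D w \<longleftrightarrow> monomial w \<in> ?I" for w
  have sign: "- (special_sign :: 'k) \<noteq> 0"
    by (simp add: special_sign_def)
  have relator: "dual_relator special_point j \<in> ?I" for j
    by (simp add: two_sided_span_superset)
  have yz: "D (u @ [gy, gz] @ v)" and zx: "D (u @ [gz, gx] @ v)" for u v
  proof -
    have multiple: "monomial u * dual_relator special_point j * monomial v \<in> ?I" for j
      by (simp add: two_sided_span_generator)
    show "D (u @ [gy, gz] @ v)" "D (u @ [gz, gx] @ v)"
      using multiple[of "(gx, True)"] multiple[of "(gy, True)"]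
      by (simp_all add: D_def special_point_coordinates monomial_mult)
  qed
  have zy: "D (u @ [gz, gy] @ v) \<longleftrightarrow> D (u @ [gx, gx] @ v)" for u v
    unfolding D_def using relator[of "(gx, False)"]
    by (intro two_sided_span_exchange[of _ "- 1"]) (simp_all add: special_point_coordinates)
  have xz: "D (u @ [gx, gz] @ v) \<longleftrightarrow> D (u @ [gy, gy] @ v)" for u v
    unfolding D_def using relator[of "(gy, False)"]
    by (intro two_sided_span_exchange[of _ "- 1"]) (simp_all add: special_point_coordinates)
  have xy: "D (u @ [gx, gy] @ v) \<longleftrightarrow> D (u @ [gz, gz] @ v)" for u v
    unfolding D_def using relator[of "(gz, True)"]
    by (intro two_sided_span_exchange[of _ "- 1"]) (simp_all add: special_point_coordinates)
  have yx: "D (u @ [gy, gx] @ v) \<longleftrightarrow> D (u @ [gz, gz] @ v)" for u v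
    unfolding D_def using relator[of "(gz, False)"] sign
    by (intro two_sided_span_exchange[of _ "- special_sign"]) (simp_all add: special_point_coordinates)
  have dead: "D [gy, gz, c]" "D [c, gy, gz]" "D [gz, gx, c]" "D [c, gz, gx]" for c
    using yz[of "[]" "[c]"] yz[of "[c]" "[]"] zx[of "[]" "[c]"] zx[of "[c]" "[]"] by simp_all
  have left: "D [gz, gy, c] \<longleftrightarrow> D [gx, gx, c]" "D [gx, gz, c] \<longleftrightarrow> D [gy, gy, c]"
    "D [gx, gy, c] \<longleftrightarrow> D [gz, gz, c]" "D [gy, gx, c] \<longleftrightarrow> D [gz, gz, c]" for c
    using zy[of "[]" "[c]"] xz[of "[]" "[c]"] xy[of "[]" "[c]"] yx[of "[]" "[c]"] by simp_all
  have right: "D [c, gz, gy] \<longleftrightarrow> D [c, gx, gx]" "D [c, gx, gz] \<longleftrightarrow> D [c, gy, gy]"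
    "D [c, gx, gy] \<longleftrightarrow> D [c, gz, gz]" "D [c, gy, gx] \<longleftrightarrow> D [c, gz, gz]" for c
    using zy[of "[c]" "[]"] xz[of "[c]" "[]"] xy[of "[c]" "[]"] yx[of "[c]" "[]"] by simp_all
  have cubes: "D [gz, gz, gz]" "D [gx, gx, gx]" "D [gy, gy, gy]"
    using dead left right by blast+
  have squares: "D [gx, gx, gy]" "D [gx, gx, gz]" "D [gy, gy, gx]" "D [gy, gy, gz]" "D [gz, gz, gx]" "D [gz, gz, gy]"
    using dead left right by blast+
  obtain a b c where w: "w = [a, b, c]"
    using assms by (auto simp: length_Suc_conv numeral_3_eq_3)
  have "D [a, b, c]"
    by (cases a; cases b; cases c) (simp_all add: cubes squares dead left)
  then show ?thesis
    by (simp add: D_def w)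
qed

section \<open>A nonempty open set of parameters\<close>

theorem theorem7p1:
  shows "\<exists>U :: ('k::field ^ 9) set. zariski_open U \<and> U \<noteq> {} \<and>
    (\<forall>\<xi>\<in>U. finite_dimensional (sklyanin_algebra \<xi>) \<and> finite_dimensional (sklyanin_dual \<xi>))"
proof -
  obtain d :: "'k ^ 9 \<Rightarrow> 'k" where d: "polynomial_function d" "d special_point \<noteq> 0"
    and d_words: "\<And>\<xi> w. d \<xi> \<noteq> 0 \<Longrightarrow> length w = 32 \<Longrightarrow> monomial w \<in> two_sided_span (range (sklyanin_relator \<xi>))"
  proof (rule words_in_two_sided_span_open[OF sklyanin_relator_quadratic sklyanin_relator_polynomial])
    show "monomial w \<in> (special_ideal :: (gen, 'k) tensor set)" if "length w = 32" for w
      using that by (rule word_32_in_special_ideal)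
  qed (rule that)
  obtain e :: "'k ^ 9 \<Rightarrow> 'k" where e: "polynomial_function e" "e special_point \<noteq> 0"
    and e_words: "\<And>\<xi> w. e \<xi> \<noteq> 0 \<Longrightarrow> length w = 3 \<Longrightarrow> monomial w \<in> two_sided_span (range (dual_relator \<xi>))"
  proof (rule words_in_two_sided_span_open[OF dual_relator_quadratic dual_relator_polynomial])
    show "monomial w \<in> two_sided_span (range (dual_relator (special_point :: 'k ^ 9)))" if "length w = 3" for w
      using that by (rule word_3_in_special_dual_ideal)
  qed (rule that)
  let ?U = "{\<xi>. d \<xi> * e \<xi> \<noteq> 0}"
  have "zariski_open ?U"
    by (intro zariski_open_nonzero polynomial_function_mult d(1) e(1))
  moreover have "special_point \<in> ?U"
    using d(2) e(2) by simp
  moreover have "finite_dimensional (sklyanin_algebra \<xi>)" if "\<xi> \<in> ?U" for \<xi>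
  proof -
    have "two_sided_span (range (sklyanin_relator \<xi>)) \<subseteq> relation_ideal (sklyanin_relations \<xi>)"
      using sklyanin_relator_in_relations relation_ideal_superset
      by (intro two_sided_span_subset_relation_ideal) blast
    then show ?thesis
      unfolding sklyanin_algebra_def using d_words that
      by (intro finite_dimensional_quadratic_algebra[of 32]) auto
  qed
  moreover have "finite_dimensional (sklyanin_dual \<xi>)" if "\<xi> \<in> ?U" for \<xi>
  proof -
    have "two_sided_span (range (dual_relator \<xi>)) \<subseteq> relation_ideal (quadratic_perp (sklyanin_relations \<xi>))"
      using dual_relator_in_perp relation_ideal_superset
      by (intro two_sided_span_subset_relation_ideal) blast
    then show ?thesis
      unfolding sklyanin_dual_def dual_algebra_def using e_words that
      by (intro finite_dimensional_quadratic_algebra[of 3]) auto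
  qed
  ultimately show ?thesis
    by blast
qed

end
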